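(* Assume (A1) and (A2), and let $\beta\in[0,1]$. Consider Algorithm 2 (the derivative-free variant of the M-CRM), where $x_t\neq x_{t-1}$ for all $t$, so that all finite-difference stepsizes are positive. Then Algorithm 2 requires at most $\mathcal O\big(n^{3(1-\beta)/2}\varepsilon^{-3/2}\big)$ (outer) iterations to generate an $\varepsilon$-approximate Pareto critical point of $\min_{x\in\mathbb R^n}F(x)$, and the total number of evaluations of the functions $F_j$ required to generate such a point is $\mathcal O\big(m\,n^{(7-3\beta)/2}\varepsilon^{-3/2}\big)$.
   Context: Setting: $F=(F_1,\dots,F_m):\mathbb R^n\to\mathbb R^m$ is twice continuously differentiable, $\mathcal J=\{1,\dots,m\}$; $\|\cdot\|$ is the Euclidean norm and the induced operator norm; $e_i$ is the $i$-th canonical basis vector. (A1): for every $j\in\mathcal J$, $\|\nabla^2F_j(y)-\nabla^2F_j(z)\|\le L_j\|y-z\|$ for all $y,z\in\mathbb R^n$; $L:=\max_{j}L_j$. (A2): for every $j\in\mathcal J$ there is $F_j^*\in\mathbb R$ with $F_j(y)\ge F_j^*$ for all $y\in\mathbb R^n$. A point $\bar x$ is an $\varepsilon$-approximate Pareto critical point if there is $\bar\lambda\in\mathbb R^m_+$ with $\sum_j\bar\lambda_j=1$ and $\|\sum_j\bar\lambda_j\nabla F_j(\bar x)\|\le\varepsilon$. Algorithm 2. Step 0: choose $x_0,x_1\in\mathbb R^n$ with $x_0\neq x_1$, $\beta\ge0$, $\sigma_1>0$, $\theta\ge0$, $\alpha>1$; set $t:=1$. Step 1: let $i\ge0$ be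 the smallest integer with $\alpha^{i-1}\sigma_t\ge\sigma_1$. Step 1.1: set $h=\min\Big\{\frac{\sqrt6}{(n^\beta\alpha^{i-1})^{1/2}},\frac{3}{2n^\beta\alpha^{i-1}}\Big\}\|x_t-x_{t-1}\|$ and, for every $j\in\mathcal J$, with $x=x_t$, let $\nabla\bar F_j(x)$ be the vector with $k$-th entry $\frac{F_j(x+he_k)-F_j(x-he_k)}{2h}$, and $\nabla^2\bar F_j(x)=\frac12(A_j+A_j^T)$, where $A_j\in\mathbb R^{n\times n}$ is given, for all $k,l=1,\dots,n$, by either $$(A_j)_{kl}=\frac{F_j(x+h(e_k+e_l))-F_j(x+h(e_k-e_l))-F_j(x+h(e_l-e_k))+F_j(x-h(e_k+e_l))}{4h^2}$$ or $$(A_j)_{kl}=\frac{F_j(x+h(e_k+e_l))-F_j(x+he_k)-F_j(x+he_l)+F_j(x)}{h^2}.$$ Step 1.2: with $M^j_{x,\sigma}(y):=\langle\nabla\bar F_j(x),y-x\rangle+\frac12\langle\nabla^2\bar F_j(x)(y-x),y-x\rangle+\frac{\sigma}{6}\|y-x\|^3$ and $M_{x,\sigma}(y):=\max_{j}M^j_{x,\sigma}(y)$, compute $(x^+_{t,i},\lambda^+_{t,i})\in\mathbb R^n\times\mathbb R^m_+$ with $M_{x_t,\alpha^i\sigma_t}(x^+_{t,i})\le0$, $\sum_j(\lambda^+_{t,i})_j=1$, and $\big\|\sum_j(\lambda^+_{t,i})_j\nabla M^j_{x_t,\alpha^i\sigma_t}(x^+_{t,i})\big\|\le\theta\|x^+_{t,i}-x_t\|^2$.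 Step 1.3: if $F_j(x_t)-F_j(x^+_{t,i})\ge\frac{\alpha^i\sigma_t}{12}\|x^+_{t,i}-x_t\|^3-\frac{\sigma_t}{12}\|x_t-x_{t-1}\|^3$ for all $j\in\mathcal J$, set $i_t=i$ and go to Step 2; otherwise set $i:=i+1$ and go to Step 1.1. Step 2: set $x_{t+1}=x^+_{t,i_t}$, $\lambda_{t+1}=\lambda^+_{t,i_t}$, $\sigma_{t+1}=\alpha^{i_t-1}\sigma_t$, $t:=t+1$, and go to Step 1. Outer iterations are indexed by $t$. Each inner iteration (Steps 1.1–1.3 for one value of $i$) uses $\mathcal O(mn^2)$ evaluations of the functions $F_j$. The $\mathcal O(\cdot)$ bounds are for $\varepsilon\in(0,1]$, with implied constants depending only on $L$, $\theta$, $\sigma_1$, $\alpha$, $\min_j[F_j(x_1)-F_j^*]$ and $\|x_1-x_0\|$ (not on $n,m,\varepsilon$). *)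

theory Defs
  imports "HOL-Analysis.Analysis"
begin

section \<open>The spaces \<open>\<real>\<^sup>n\<close>, with \<open>n\<close> a variable\<close>

text \<open>
  The implied constants of the complexity bounds are uniform in the dimension, so they have to be
  quantified before \<open>n\<close>, and \<open>n\<close> cannot be the cardinality of an index type.
  Following \<^const>\<open>Euclidean_space\<close>, \<open>\<real>\<^sup>n\<close> is the set of real sequences that
  vanish from index \<open>n\<close> on. All these sets live in the inner product space of finitely supported
  real sequences, whose inner product restricts to the Euclidean one. Coordinates, basis vectors and
  objectives are numbered from \<open>0\<close>.
\<close>

typedef fvec = "{x :: nat \<Rightarrow> real. finite {i. x i \<noteq> 0}}"
  morphisms coord Fvec
  by (rule exI[of _ "\<lambda>_. 0"]) simp

setup_lifting type_definition_fvec

lemma finite_support_coord [simp]: "finite {i. coord x i \<noteq> 0}"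
  using coord[of x] by simp

lemma fvec_eqI: "(\<And>i. coord x i = coord y i) \<Longrightarrow> x = y"
  by (simp add: coord_inject[symmetric] fun_eq_iff)

instantiation fvec :: real_vector
begin

lift_definition zero_fvec :: fvec is "\<lambda>_. 0" by simp

lift_definition plus_fvec :: "fvec \<Rightarrow> fvec \<Rightarrow> fvec" is "\<lambda>x y i. x i + y i"
proof -
  fix x y :: "nat \<Rightarrow> real"
  assume "finite {i. x i \<noteq> 0}" "finite {i. y i \<noteq> 0}"
  then have "finite ({i. x i \<noteq> 0} \<union> {i. y i \<noteq> 0})" by simp
  then show "finite {i. x i + y i \<noteq> 0}"
    by (rule rev_finite_subset) auto
qed

lift_definition minus_fvec :: "fvec \<Rightarrow> fvec \<Rightarrow> fvec" is "\<lambda>x y i. x i - y i"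
proof -
  fix x y :: "nat \<Rightarrow> real"
  assume "finite {i. x i \<noteq> 0}" "finite {i. y i \<noteq> 0}"
  then have "finite ({i. x i \<noteq> 0} \<union> {i. y i \<noteq> 0})" by simp
  then show "finite {i. x i - y i \<noteq> 0}"
    by (rule rev_finite_subset) auto
qed

lift_definition uminus_fvec :: "fvec \<Rightarrow> fvec" is "\<lambda>x i. - x i"
  by simp

lift_definition scaleR_fvec :: "real \<Rightarrow> fvec \<Rightarrow> fvec" is "\<lambda>r x i. r * x i"
proof -
  fix r :: real and x :: "nat \<Rightarrow> real"
  assume "finite {i. x i \<noteq> 0}"
  then show "finite {i. r * x i \<noteq> 0}"
    by (rule rev_finite_subset) auto
qed

instance
  by standard (rule fvec_eqI; simp add: zero_fvec.rep_eq plus_fvec.rep_eq minus_fvec.rep_eq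
    uminus_fvec.rep_eq scaleR_fvec.rep_eq algebra_simps)+

end

lemma coord_zero [simp]: "coord 0 i = 0"
  and coord_add [simp]: "coord (x + y) i = coord x i + coord y i"
  and coord_diff [simp]: "coord (x - y) i = coord x i - coord y i"
  and coord_minus [simp]: "coord (- x) i = - coord x i"
  and coord_scaleR [simp]: "coord (r *\<^sub>R x) i = r * coord x i"
  by (simp_all add: zero_fvec.rep_eq plus_fvec.rep_eq minus_fvec.rep_eq uminus_fvec.rep_eq
    scaleR_fvec.rep_eq)

lemma coord_sum [simp]: "coord (sum f A) i = (\<Sum>a\<in>A. coord (f a) i)"
  by (induction A rule: infinite_finite_induct) auto

definition fvec_dot :: "fvec \<Rightarrow> fvec \<Rightarrow> real" where
  "fvec_dot x y = (\<Sum>i | coord x i \<noteq> 0. coord x i * coord y i)"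

lemma fvec_dot_superset:
  assumes "finite A" "\<And>i. i \<notin> A \<Longrightarrow> coord x i = 0 \<or> coord y i = 0"
  shows "fvec_dot x y = (\<Sum>i\<in>A. coord x i * coord y i)"
proof -
  let ?S = "{i. coord x i \<noteq> 0}"
  have "fvec_dot x y = (\<Sum>i\<in>A \<union> ?S. coord x i * coord y i)"
    unfolding fvec_dot_def using assms(1) by (intro sum.mono_neutral_left) auto
  also have "\<dots> = (\<Sum>i\<in>A. coord x i * coord y i)"
    using assms by (intro sum.mono_neutral_right) auto
  finally show ?thesis .
qed

instantiation fvec :: real_inner
begin

definition inner_fvec :: "fvec \<Rightarrow> fvec \<Rightarrow> real" where
  "inner_fvec = fvec_dot"

definition norm_fvec :: "fvec \<Rightarrow> real" where
  "norm_fvec x = sqrt (inner x x)"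

definition dist_fvec :: "fvec \<Rightarrow> fvec \<Rightarrow> real" where
  "dist_fvec x y = norm (x - y)"

definition sgn_fvec :: "fvec \<Rightarrow> fvec" where
  "sgn_fvec x = inverse (norm x) *\<^sub>R x"

definition uniformity_fvec :: "(fvec \<times> fvec) filter" where
  "uniformity_fvec = (INF e\<in>{0<..}. principal {(x, y). dist x y < e})"

definition open_fvec :: "fvec set \<Rightarrow> bool" where
  "open_fvec U \<longleftrightarrow> (\<forall>x\<in>U. \<forall>\<^sub>F (x', y) in uniformity. x' = x \<longrightarrow> y \<in> U)"

instance
proof
  fix x y z :: fvec and r :: real and U :: "fvec set"
  let ?S = "\<lambda>x. {i. coord x i \<noteq> 0}"
  show "dist x y = norm (x - y)" by (rule dist_fvec_def)
  show "sgn x = inverse (norm x) *\<^sub>R x" by (rule sgn_fvec_def)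
  show "(uniformity :: (fvec \<times> fvec) filter) = (INF e\<in>{0<..}. principal {(x, y). dist x y < e})"
    by (rule uniformity_fvec_def)
  show "open U \<longleftrightarrow> (\<forall>x\<in>U. \<forall>\<^sub>F (x', y) in uniformity. x' = x \<longrightarrow> y \<in> U)"
    by (rule open_fvec_def)
  have dot: "inner a b = (\<Sum>i\<in>?S x \<union> ?S y \<union> ?S z. coord a i * coord b i)"
    if "?S a \<subseteq> ?S x \<union> ?S y \<union> ?S z" for a b
    unfolding inner_fvec_def using that by (intro fvec_dot_superset) auto
  show "inner x y = inner y x"
    by (subst (1 2) dot) (auto simp: mult.commute)
  show "inner (x + y) z = inner x z + inner y z"
    by (subst (1 2 3) dot) (auto simp: sum.distrib algebra_simps)
  show "inner (r *\<^sub>R x) y = r * inner x y"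
    by (subst (1 2) dot) (auto simp: sum_distrib_left algebra_simps)
  show "0 \<le> inner x x"
    by (simp add: inner_fvec_def fvec_dot_def sum_nonneg)
  show "inner x x = 0 \<longleftrightarrow> x = 0"
    by (auto simp: inner_fvec_def fvec_dot_def sum_nonneg_eq_0_iff intro: fvec_eqI)
  show "norm x = sqrt (inner x x)" by (rule norm_fvec_def)
qed

end

definition Rn :: "nat \<Rightarrow> fvec set" where
  "Rn n = {x. \<forall>i\<ge>n. coord x i = 0}"

lift_definition unit_vec :: "nat \<Rightarrow> fvec" is "\<lambda>k i. if i = k then 1 else 0"
  by simp

lemma coord_unit_vec [simp]: "coord (unit_vec k) i = (if i = k then 1 else 0)"
  by (simp add: unit_vec.rep_eq)

lemma unit_vec_in_Rn: "k < n \<Longrightarrow> unit_vec k \<in> Rn n"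
  by (simp add: Rn_def)

lemma inner_Rn: "x \<in> Rn n \<Longrightarrow> inner x y = (\<Sum>i<n. coord x i * coord y i)"
  unfolding inner_fvec_def by (rule fvec_dot_superset) (auto simp: Rn_def not_less)

lemma norm_Rn: "x \<in> Rn n \<Longrightarrow> norm x = L2_set (coord x) {..<n}"
  unfolding norm_fvec_def L2_set_def by (simp only: inner_Rn power2_eq_square)

lemma coord_image_Rn: "coord ` Rn n = topspace (Euclidean_space n)"
proof (intro set_eqI iffI)
  fix f assume "f \<in> topspace (Euclidean_space n)"
  then have f0: "\<forall>i\<ge>n. f i = 0" by (simp add: topspace_Euclidean_space)
  then have "{i. f i \<noteq> 0} \<subseteq> {..<n}" by (metis (mono_tags, lifting) lessThan_iff mem_Collect_eq not_le subsetI)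
  then have "finite {i. f i \<noteq> 0}" by (rule finite_subset) simp
  then have "coord (Fvec f) = f" by (simp add: Fvec_inverse)
  then show "f \<in> coord ` Rn n" using f0 by (intro image_eqI[of _ _ "Fvec f"]) (auto simp: Rn_def)
qed (auto simp: Rn_def topspace_Euclidean_space)

section \<open>Derivatives and matrices\<close>

text \<open>Functions on \<open>\<real>\<^sup>n\<close> are represented by functions on \<^typ>\<open>fvec\<close>;
  their values outside \<^term>\<open>Rn n\<close> are never used.\<close>

definition has_gradient :: "nat \<Rightarrow> (fvec \<Rightarrow> real) \<Rightarrow> fvec \<Rightarrow> fvec \<Rightarrow> bool" where
  "has_gradient n f g x \<longleftrightarrow> g \<in> Rn n \<and> (f has_derivative (\<lambda>v. inner g v)) (at x within Rn n)"

definition gradient :: "nat \<Rightarrow> (fvec \<Rightarrow> real) \<Rightarrow> fvec \<Rightarrow> fvec" where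
  "gradient n f x = (THE g. has_gradient n f g x)"

lemma has_gradient_unique:
  assumes x: "x \<in> Rn n" and g: "has_gradient n f g x" and g': "has_gradient n f g' x"
  shows "g = g'"
proof (rule fvec_eqI)
  fix k
  show "coord g k = coord g' k"
  proof (cases "k < n")
    case True
    let ?p = "\<lambda>s::real. x + s *\<^sub>R unit_vec k"
    have p: "(?p has_derivative (\<lambda>s. s *\<^sub>R unit_vec k)) (at 0)"
      by (auto intro!: derivative_eq_intros)
    have im: "range ?p \<subseteq> Rn n" using x True by (auto simp: Rn_def)
    have "((\<lambda>s. f (?p s)) has_derivative (\<lambda>s. inner h (s *\<^sub>R unit_vec k))) (at 0)"
      if "has_gradient n f h x" for h
    proof -
      have "(f has_derivative (\<lambda>v. inner h v)) (at (?p 0) within range ?p)"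
        using that im unfolding has_gradient_def by (auto intro: has_derivative_subset)
      from has_derivative_in_compose[OF p this] show ?thesis .
    qed
    from has_derivative_unique[OF this[OF g] this[OF g']]
    have "inner g (1 *\<^sub>R unit_vec k) = inner g' (1 *\<^sub>R unit_vec k)" by (rule fun_cong)
    moreover have "inner h (1 *\<^sub>R unit_vec k) = coord h k" if "h \<in> Rn n" for h
      using inner_Rn[OF that, of "unit_vec k"] True by (simp add: if_distrib cong: if_cong)
    ultimately show ?thesis using g g' by (simp add: has_gradient_def)
  next
    case False
    then show ?thesis using g g' by (simp add: has_gradient_def Rn_def)
  qed
qed

lemma gradient_eq: "x \<in> Rn n \<Longrightarrow> has_gradient n f g x \<Longrightarrow> gradient n f x = g"
  unfolding gradient_def by (blast intro: the_equality has_gradient_unique)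

type_synonym mat = "nat \<Rightarrow> nat \<Rightarrow> real"  \<comment> \<open>only the entries with both indices below \<open>n\<close> matter\<close>

definition hessian :: "nat \<Rightarrow> (fvec \<Rightarrow> real) \<Rightarrow> fvec \<Rightarrow> mat" where
  "hessian n f x k l = coord (gradient n (\<lambda>z. coord (gradient n f z) k) x) l"

definition twice_cont_diff :: "nat \<Rightarrow> (fvec \<Rightarrow> real) \<Rightarrow> bool" where
  "twice_cont_diff n f \<longleftrightarrow>
     (\<forall>x\<in>Rn n. \<exists>g. has_gradient n f g x) \<and>
     (\<forall>x\<in>Rn n. \<forall>k<n. \<exists>g. has_gradient n (\<lambda>z. coord (gradient n f z) k) g x) \<and>
     (\<forall>k<n. \<forall>l<n. continuous_on (Rn n) (\<lambda>x. hessian n f x k l))"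

definition mat_vec :: "nat \<Rightarrow> mat \<Rightarrow> fvec \<Rightarrow> fvec" where
  "mat_vec n A v = (\<Sum>k<n. (\<Sum>l<n. A k l * coord v l) *\<^sub>R unit_vec k)"

text \<open>\<^term>\<open>mat_vec n A\<close> factors through the orthogonal projection onto \<^term>\<open>Rn n\<close>, so the
  supremum in \<^const>\<open>onorm\<close>, although over all of \<^typ>\<open>fvec\<close>, is attained on \<^term>\<open>Rn n\<close>.\<close>

definition mat_norm :: "nat \<Rightarrow> mat \<Rightarrow> real" where
  "mat_norm n A = onorm (mat_vec n A)"

definition approx_pareto_critical :: "nat \<Rightarrow> nat \<Rightarrow> (nat \<Rightarrow> fvec \<Rightarrow> real) \<Rightarrow> real \<Rightarrow> fvec \<Rightarrow> bool" where
  "approx_pareto_critical n m F \<epsilon> x \<longleftrightarrow>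
     x \<in> Rn n \<and>
     (\<exists>w :: nat \<Rightarrow> real. (\<forall>j<m. 0 \<le> w j) \<and> (\<Sum>j<m. w j) = 1 \<and>
        norm (\<Sum>j<m. w j *\<^sub>R gradient n (F j) x) \<le> \<epsilon>)"

section \<open>Finite differences\<close>

definition fd_gradient :: "nat \<Rightarrow> (fvec \<Rightarrow> real) \<Rightarrow> real \<Rightarrow> fvec \<Rightarrow> fvec" where
  "fd_gradient n f h x =
     (\<Sum>k<n. ((f (x + h *\<^sub>R unit_vec k) - f (x - h *\<^sub>R unit_vec k)) / (2 * h)) *\<^sub>R unit_vec k)"

datatype scheme = Central | Forward

primrec fd_matrix :: "scheme \<Rightarrow> (fvec \<Rightarrow> real) \<Rightarrow> real \<Rightarrow> fvec \<Rightarrow> mat" where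
  "fd_matrix Central f h x k l =
     (f (x + h *\<^sub>R (unit_vec k + unit_vec l)) - f (x + h *\<^sub>R (unit_vec k - unit_vec l))
      - f (x + h *\<^sub>R (unit_vec l - unit_vec k)) + f (x - h *\<^sub>R (unit_vec k + unit_vec l))) / (4 * h^2)"
| "fd_matrix Forward f h x k l =
     (f (x + h *\<^sub>R (unit_vec k + unit_vec l)) - f (x + h *\<^sub>R unit_vec k)
      - f (x + h *\<^sub>R unit_vec l) + f x) / h^2"

definition fd_hessian :: "scheme \<Rightarrow> (fvec \<Rightarrow> real) \<Rightarrow> real \<Rightarrow> fvec \<Rightarrow> mat" where
  "fd_hessian s f h x k l = (fd_matrix s f h x k l + fd_matrix s f h x l k) / 2"

text \<open>The points at which a single objective is evaluated in one inner iteration: for the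
  finite differences at \<open>x\<close>, and at \<open>x\<close> and the trial point \<open>y\<close> for the acceptance test.
  Every occurrence of a function value in the formulas is counted, i.e. no value is reused, which
  gives \<open>2 * n + 4 * n^2 + 2\<close> evaluations.\<close>

definition gradient_points :: "nat \<Rightarrow> real \<Rightarrow> fvec \<Rightarrow> fvec list" where
  "gradient_points n h x =
     concat (map (\<lambda>k. [x + h *\<^sub>R unit_vec k, x - h *\<^sub>R unit_vec k]) [0..<n])"

primrec entry_points :: "scheme \<Rightarrow> real \<Rightarrow> fvec \<Rightarrow> nat \<Rightarrow> nat \<Rightarrow> fvec list" where
  "entry_points Central h x k l =
     [x + h *\<^sub>R (unit_vec k + unit_vec l), x + h *\<^sub>R (unit_vec k - unit_vec l),
      x + h *\<^sub>R (unit_vec l - unit_vec k), x - h *\<^sub>R (unit_vec k + unit_vec l)]"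
| "entry_points Forward h x k l =
     [x + h *\<^sub>R (unit_vec k + unit_vec l), x + h *\<^sub>R unit_vec k, x + h *\<^sub>R unit_vec l, x]"

definition hessian_points :: "scheme \<Rightarrow> nat \<Rightarrow> real \<Rightarrow> fvec \<Rightarrow> fvec list" where
  "hessian_points s n h x =
     concat (map (\<lambda>k. concat (map (\<lambda>l. entry_points s h x k l) [0..<n])) [0..<n])"

definition evaluation_points :: "scheme \<Rightarrow> nat \<Rightarrow> real \<Rightarrow> fvec \<Rightarrow> fvec \<Rightarrow> fvec list" where
  "evaluation_points s n h x y = gradient_points n h x @ hessian_points s n h x @ [x, y]"

section \<open>The algorithm\<close>

definition cubic_model :: "nat \<Rightarrow> fvec \<Rightarrow> mat \<Rightarrow> real \<Rightarrow> fvec \<Rightarrow> fvec \<Rightarrow> real" where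
  "cubic_model n g H \<sigma> x y =
     inner g (y - x) + 1 / 2 * inner (mat_vec n H (y - x)) (y - x) + \<sigma> / 6 * norm (y - x) ^ 3"

text \<open>A run is described by the sequence of its inner iterations. The state before an inner
  iteration consists of the counters \<open>t\<close> and \<open>i\<close>, the points \<open>x\<^sub>t\<^sub>-\<^sub>1\<close> and \<open>x\<^sub>t\<close>, the
  parameter \<open>\<sigma>\<^sub>t\<close>, and the number of evaluations of objectives made so far. In this way,
  that the inner loops terminate is not built into the notion of a run.\<close>

record alg_state =
  outer_idx :: nat
  inner_idx :: nat
  x_prev :: fvec
  x_cur :: fvec
  sigma_cur :: real
  evals :: nat

definition first_inner :: "real \<Rightarrow> real \<Rightarrow> real \<Rightarrow> nat" where
  "first_inner \<alpha> \<sigma>1 \<sigma> = (LEAST i. \<alpha> powi (int i - 1) * \<sigma> \<ge> \<sigma>1)"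

definition stepsize :: "nat \<Rightarrow> real \<Rightarrow> real \<Rightarrow> alg_state \<Rightarrow> real" where
  "stepsize n \<beta> \<alpha> c =
     (let q = real n powr \<beta> * \<alpha> powi (int (inner_idx c) - 1)
      in min (sqrt 6 / sqrt q) (3 / (2 * q)) * norm (x_cur c - x_prev c))"

definition alg_model ::
  "nat \<Rightarrow> (nat \<Rightarrow> fvec \<Rightarrow> real) \<Rightarrow> real \<Rightarrow> real \<Rightarrow> (nat \<Rightarrow> scheme) \<Rightarrow> alg_state \<Rightarrow> nat \<Rightarrow> fvec \<Rightarrow> real" where
  "alg_model n F \<beta> \<alpha> S c j =
     (let h = stepsize n \<beta> \<alpha> c; x = x_cur c
      in cubic_model n (fd_gradient n (F j) h x) (fd_hessian (S j) (F j) h x)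
           (\<alpha> ^ inner_idx c * sigma_cur c) x)"

definition trial_ok ::
  "nat \<Rightarrow> nat \<Rightarrow> (nat \<Rightarrow> fvec \<Rightarrow> real) \<Rightarrow> real \<Rightarrow> real \<Rightarrow> real \<Rightarrow> (nat \<Rightarrow> scheme) \<Rightarrow> alg_state \<Rightarrow> fvec \<Rightarrow> (nat \<Rightarrow> real) \<Rightarrow> bool" where
  "trial_ok n m F \<beta> \<theta> \<alpha> S c y w \<longleftrightarrow>
     y \<in> Rn n \<and> (\<forall>j<m. 0 \<le> w j) \<and>
     Max ((\<lambda>j. alg_model n F \<beta> \<alpha> S c j y) ` {..<m}) \<le> 0 \<and>
     (\<Sum>j<m. w j) = 1 \<and>
     norm (\<Sum>j<m. w j *\<^sub>R gradient n (alg_model n F \<beta> \<alpha> S c j) y) \<le> \<theta> * norm (y - x_cur c) ^ 2"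

definition sufficient_decrease ::
  "nat \<Rightarrow> (nat \<Rightarrow> fvec \<Rightarrow> real) \<Rightarrow> real \<Rightarrow> alg_state \<Rightarrow> fvec \<Rightarrow> bool" where
  "sufficient_decrease m F \<alpha> c y \<longleftrightarrow>
     (\<forall>j<m. F j (x_cur c) - F j y \<ge>
        \<alpha> ^ inner_idx c * sigma_cur c / 12 * norm (y - x_cur c) ^ 3
        - sigma_cur c / 12 * norm (x_cur c - x_prev c) ^ 3)"

definition iteration_evals ::
  "nat \<Rightarrow> nat \<Rightarrow> real \<Rightarrow> real \<Rightarrow> (nat \<Rightarrow> scheme) \<Rightarrow> alg_state \<Rightarrow> fvec \<Rightarrow> nat" where
  "iteration_evals n m \<beta> \<alpha> S c y =
     (\<Sum>j<m. length (evaluation_points (S j) n (stepsize n \<beta> \<alpha> c) (x_cur c) y))"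

text \<open>One inner iteration. The choice of a finite-difference scheme \<open>S j\<close> is free for each
  objective and may change from one inner iteration to the next.\<close>

inductive alg_step ::
  "nat \<Rightarrow> nat \<Rightarrow> (nat \<Rightarrow> fvec \<Rightarrow> real) \<Rightarrow> real \<Rightarrow> real \<Rightarrow> real \<Rightarrow> real \<Rightarrow> alg_state \<Rightarrow> alg_state \<Rightarrow> bool"
  for n m F \<beta> \<sigma>1 \<theta> \<alpha>
where
  accept: "\<lbrakk>trial_ok n m F \<beta> \<theta> \<alpha> S c y w; sufficient_decrease m F \<alpha> c y;
            \<sigma>' = \<alpha> powi (int (inner_idx c) - 1) * sigma_cur c\<rbrakk> \<Longrightarrow>
     alg_step n m F \<beta> \<sigma>1 \<theta> \<alpha> c
       \<lparr>outer_idx = outer_idx c + 1, inner_idx = first_inner \<alpha> \<sigma>1 \<sigma>', x_prev = x_cur c, x_cur = y,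
        sigma_cur = \<sigma>', evals = evals c + iteration_evals n m \<beta> \<alpha> S c y\<rparr>"
| reject: "\<lbrakk>trial_ok n m F \<beta> \<theta> \<alpha> S c y w; \<not> sufficient_decrease m F \<alpha> c y\<rbrakk> \<Longrightarrow>
     alg_step n m F \<beta> \<sigma>1 \<theta> \<alpha> c
       (c\<lparr>inner_idx := inner_idx c + 1, evals := evals c + iteration_evals n m \<beta> \<alpha> S c y\<rparr>)"

definition alg_run ::
  "nat \<Rightarrow> nat \<Rightarrow> (nat \<Rightarrow> fvec \<Rightarrow> real) \<Rightarrow> real \<Rightarrow> real \<Rightarrow> real \<Rightarrow> real \<Rightarrow> fvec \<Rightarrow> fvec \<Rightarrow> (nat \<Rightarrow> alg_state) \<Rightarrow> bool" where
  "alg_run n m F \<beta> \<sigma>1 \<theta> \<alpha> x0 x1 c \<longleftrightarrow>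
     x0 \<in> Rn n \<and> x1 \<in> Rn n \<and> x0 \<noteq> x1 \<and> \<beta> \<ge> 0 \<and> \<sigma>1 > 0 \<and> \<theta> \<ge> 0 \<and> \<alpha> > 1 \<and>
     c 0 = \<lparr>outer_idx = 1, inner_idx = first_inner \<alpha> \<sigma>1 \<sigma>1, x_prev = x0, x_cur = x1,
            sigma_cur = \<sigma>1, evals = 0\<rparr> \<and>
     (\<forall>s. alg_step n m F \<beta> \<sigma>1 \<theta> \<alpha> (c s) (c (Suc s)))"

end

theory Submission
  imports Defs
begin

text \<open>
  Write \<open>s\<^sub>t = \<parallel>x\<^sub>t - x\<^sub>t\<^sub>-\<^sub>1\<parallel>\<close> and \<open>e = n\<^sup>1\<^sup>-\<^sup>\<beta>\<close>. The stepsize makes the errors of the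
  finite-difference gradient and Hessian at \<open>x\<^sub>t\<close> at most \<open>L e s\<^sub>t\<^sup>2 / \<alpha>\<^sup>i\<^sup>-\<^sup>1\<close> and \<open>3 L e s\<^sub>t / \<alpha>\<^sup>i\<^sup>-\<^sup>1\<close>.
  Hence a trial point is accepted as soon as \<open>\<alpha>\<^sup>i\<^sup>-\<^sup>1 \<sigma>\<^sub>t \<ge> (60 L + 1) e\<close>, the error being absorbed by
  the cubic term and by the slack \<open>\<sigma>\<^sub>t s\<^sub>t\<^sup>3 / 12\<close> in the acceptance test, so \<open>\<sigma>\<^sub>t\<close> stays in an
  interval \<open>[\<sigma>\<^sub>1, O(e)]\<close>. Telescoping the acceptance test bounds \<open>\<Sum>\<^sub>t s\<^sub>t\<^sup>3\<close>. On the other hand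
  the weighted gradient at \<open>x\<^sub>t\<^sub>+\<^sub>1\<close> is \<open>O(e (s\<^sub>t\<^sup>2 + s\<^sub>t\<^sub>+\<^sub>1\<^sup>2))\<close> (here \<open>\<alpha>\<^sup>1\<^sup>-\<^sup>i \<le> \<alpha>\<close> is used), so as long as no
  critical point is met, \<open>s\<^sub>t\<^sup>3 + s\<^sub>t\<^sub>+\<^sub>1\<^sup>3\<close> is at least a constant times \<open>(\<epsilon> / e)\<^sup>3\<^sup>/\<^sup>2\<close>.
\<close>

section \<open>Coordinates, matrices and gradients\<close>

lemma inner_unit_vec: "inner x (unit_vec k) = coord x k"
proof -
  have "inner (unit_vec k) x = (\<Sum>i\<in>{k}. coord (unit_vec k) i * coord x i)"
    unfolding inner_fvec_def by (rule fvec_dot_superset) auto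
  then show ?thesis by (simp add: inner_commute)
qed

lemma norm_unit_vec [simp]: "norm (unit_vec k) = 1"
  by (simp add: norm_eq_sqrt_inner inner_unit_vec)

lemma abs_coord_le_norm: "\<bar>coord x k\<bar> \<le> norm x"
  using Cauchy_Schwarz_ineq2[of x "unit_vec k"] by (simp add: inner_unit_vec)

lemma subspace_Rn: "subspace (Rn n)"
  by (auto simp: subspace_def Rn_def)

lemma Rn_add: "x \<in> Rn n \<Longrightarrow> y \<in> Rn n \<Longrightarrow> x + y \<in> Rn n"
  and Rn_diff: "x \<in> Rn n \<Longrightarrow> y \<in> Rn n \<Longrightarrow> x - y \<in> Rn n"
  and Rn_scaleR: "x \<in> Rn n \<Longrightarrow> a *\<^sub>R x \<in> Rn n"
  and Rn_minus: "x \<in> Rn n \<Longrightarrow> - x \<in> Rn n"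
  and Rn_sum: "(\<And>i. i \<in> I \<Longrightarrow> f i \<in> Rn n) \<Longrightarrow> sum f I \<in> Rn n"
  using subspace_Rn by (auto intro: subspace_add subspace_diff subspace_scale subspace_neg subspace_sum)

lemmas Rn_intros = Rn_add Rn_diff Rn_scaleR Rn_minus unit_vec_in_Rn

lemma norm_le_of_coord_le:
  assumes "x \<in> Rn n" "\<And>k. k < n \<Longrightarrow> \<bar>coord x k\<bar> \<le> a" "0 \<le> a"
  shows "norm x \<le> sqrt n * a"
proof -
  have "norm x = L2_set (\<lambda>k. \<bar>coord x k\<bar>) {..<n}"
    by (simp add: norm_Rn[OF assms(1)] L2_set_def)
  also have "\<dots> \<le> L2_set (\<lambda>_. a) {..<n}"
    using assms by (intro L2_set_mono) auto
  also have "\<dots> = sqrt n * a"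
    using assms(3) by (simp add: L2_set_constant)
  finally show ?thesis .
qed

lemma sum_abs_coord_le:
  assumes "x \<in> Rn n"
  shows "(\<Sum>k<n. \<bar>coord x k\<bar>) \<le> sqrt n * norm x"
proof -
  have "(\<Sum>k<n. \<bar>coord x k\<bar> * \<bar>1\<bar>) \<le> L2_set (coord x) {..<n} * L2_set (\<lambda>_. 1) {..<n}"
    by (rule L2_set_mult_ineq)
  then show ?thesis by (simp add: norm_Rn[OF assms] L2_set_constant mult.commute)
qed

lemma coord_mat_vec: "coord (mat_vec n A v) k = (if k < n then \<Sum>l<n. A k l * coord v l else 0)"
  by (simp add: mat_vec_def if_distrib cong: if_cong)

lemma mat_vec_in_Rn: "mat_vec n A v \<in> Rn n"
  by (simp add: Rn_def coord_mat_vec)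

lemma mat_vec_diff: "mat_vec n (\<lambda>k l. A k l - B k l) v = mat_vec n A v - mat_vec n B v"
  by (rule fvec_eqI) (simp add: coord_mat_vec left_diff_distrib sum_subtractf)

text \<open>A crude bound for every \<open>v\<close> of the infinite-dimensional
  \<open>fvec\<close>, where linearity alone does not give boundedness.\<close>

lemma norm_mat_vec_le_sum: "norm (mat_vec n A v) \<le> norm v * (\<Sum>k<n. \<Sum>l<n. \<bar>A k l\<bar>)"
proof -
  have "norm (mat_vec n A v) \<le> (\<Sum>k<n. \<bar>\<Sum>l<n. A k l * coord v l\<bar>)"
    unfolding mat_vec_def by (rule order_trans[OF norm_sum]) simp
  also have "\<dots> \<le> (\<Sum>k<n. \<Sum>l<n. \<bar>A k l\<bar> * norm v)"
    by (intro sum_mono order_trans[OF sum_abs]) (auto simp: abs_mult intro!: mult_left_mono abs_coord_le_norm)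
  also have "\<dots> = norm v * (\<Sum>k<n. \<Sum>l<n. \<bar>A k l\<bar>)"
    by (simp add: sum_distrib_left mult.commute)
  finally show ?thesis .
qed

lemma bounded_linear_mat_vec: "bounded_linear (mat_vec n A)"
proof (rule bounded_linear_intro)
  show "mat_vec n A (x + y) = mat_vec n A x + mat_vec n A y" for x y
    by (rule fvec_eqI) (simp add: coord_mat_vec algebra_simps sum.distrib)
  show "mat_vec n A (r *\<^sub>R x) = r *\<^sub>R mat_vec n A x" for r x
    by (rule fvec_eqI) (simp add: coord_mat_vec sum_distrib_left mult_ac)
qed (rule norm_mat_vec_le_sum)

lemmas linear_mat_vec = bounded_linear.linear[OF bounded_linear_mat_vec]

lemma norm_mat_vec_le: "norm (mat_vec n A v) \<le> mat_norm n A * norm v"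
  unfolding mat_norm_def by (rule onorm[OF bounded_linear_mat_vec])

text \<open>One \<open>sqrt n\<close> comes from comparing the 1-norm of \<open>v\<close> with its
  Euclidean norm, the other from comparing the Euclidean norm of the image with its largest
  coordinate.\<close>

lemma norm_mat_vec_le_of_entries:
  assumes A: "\<And>k l. k < n \<Longrightarrow> l < n \<Longrightarrow> \<bar>A k l\<bar> \<le> a" and v: "v \<in> Rn n" and "0 \<le> a"
  shows "norm (mat_vec n A v) \<le> n * a * norm v"
proof -
  have "norm (mat_vec n A v) \<le> sqrt n * (a * (sqrt n * norm v))"
  proof (rule norm_le_of_coord_le)
    fix k assume k: "k < n"
    have "\<bar>coord (mat_vec n A v) k\<bar> \<le> (\<Sum>l<n. a * \<bar>coord v l\<bar>)"
      using k A by (auto simp: coord_mat_vec abs_mult intro!: order_trans[OF sum_abs] sum_mono mult_right_mono)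
    also have "\<dots> \<le> a * (sqrt n * norm v)"
      using sum_abs_coord_le[OF v] \<open>0 \<le> a\<close> by (simp add: sum_distrib_left[symmetric] mult_left_mono)
    finally show "\<bar>coord (mat_vec n A v) k\<bar> \<le> a * (sqrt n * norm v)" .
  qed (use \<open>0 \<le> a\<close> in \<open>auto intro: mat_vec_in_Rn\<close>)
  also have "\<dots> = n * a * norm v"
    by simp
  finally show ?thesis .
qed

lemma inner_mat_vec_unit_vec:
  "k < n \<Longrightarrow> l < n \<Longrightarrow> inner (mat_vec n A (unit_vec l)) (unit_vec k) = A k l"
  by (simp add: inner_unit_vec coord_mat_vec if_distrib cong: if_cong)

lemma inner_mat_vec_symmetric:
  assumes sym: "\<And>k l. k < n \<Longrightarrow> l < n \<Longrightarrow> A k l = A l k"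
  shows "inner (mat_vec n A v) w = inner (mat_vec n A w) v"
proof -
  have *: "inner (mat_vec n A v) w = (\<Sum>k<n. \<Sum>l<n. A k l * coord v l * coord w k)" for v w
    by (simp add: inner_Rn[OF mat_vec_in_Rn] coord_mat_vec sum_distrib_right)
  show ?thesis unfolding *
    by (subst sum.swap) (auto intro!: sum.cong simp: sym mult_ac)
qed

section \<open>Derivatives along lines in \<open>Rn n\<close>\<close>

lemma has_gradient_line:
  assumes "has_gradient n f g (x + t *\<^sub>R v)" "x \<in> Rn n" "v \<in> Rn n"
  shows "((\<lambda>s. f (x + s *\<^sub>R v)) has_real_derivative inner g v) (at t)"
proof -
  let ?p = "\<lambda>s::real. x + s *\<^sub>R v"
  have p: "(?p has_derivative (\<lambda>s. s *\<^sub>R v)) (at t)"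
    by (auto intro!: derivative_eq_intros)
  \<comment> \<open>The whole line stays in \<open>Rn n\<close>, so the derivative within
    \<open>Rn n\<close> restricts to an ordinary derivative in one real variable.\<close>
  have "range ?p \<subseteq> Rn n" using assms by (auto intro: Rn_intros)
  then have "(f has_derivative (\<lambda>v. inner g v)) (at (?p t) within range ?p)"
    using assms(1) unfolding has_gradient_def by (auto intro: has_derivative_subset)
  from has_derivative_in_compose[OF p this] show ?thesis
    by (simp add: has_field_derivative_def mult_commute_abs)
qed

lemma has_gradient_gradient:
  assumes "twice_cont_diff n f" "x \<in> Rn n"
  shows "has_gradient n f (gradient n f x) x"
  using assms gradient_eq unfolding twice_cont_diff_def by metis

lemma gradient_in_Rn: "twice_cont_diff n f \<Longrightarrow> x \<in> Rn n \<Longrightarrow> gradient n f x \<in> Rn n"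
  using has_gradient_gradient by (auto simp: has_gradient_def)

lemma has_gradient_coord_gradient:
  assumes "twice_cont_diff n f" "x \<in> Rn n" "k < n"
  shows "has_gradient n (\<lambda>z. coord (gradient n f z) k) (gradient n (\<lambda>z. coord (gradient n f z) k) x) x"
  using assms gradient_eq unfolding twice_cont_diff_def by metis

lemma gradient_line:
  assumes f: "twice_cont_diff n f" and x: "x \<in> Rn n" and v: "v \<in> Rn n" 
  shows "((\<lambda>s. inner (gradient n f (x + s *\<^sub>R v)) w) has_real_derivative
           inner (mat_vec n (hessian n f (x + t *\<^sub>R v)) v) w) (at t)"
proof -
  have xt: "x + s *\<^sub>R v \<in> Rn n" for s
    using x v by (auto intro: Rn_intros)
  have "((\<lambda>s. \<Sum>k<n. coord (gradient n f (x + s *\<^sub>R v)) k * coord w k) has_real_derivative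
      (\<Sum>k<n. inner (gradient n (\<lambda>z. coord (gradient n f z) k) (x + t *\<^sub>R v)) v * coord w k)) (at t)"
    using has_gradient_coord_gradient[OF f xt] x v
    by (auto intro!: DERIV_sum DERIV_cmult_right has_gradient_line)
  also have "(\<lambda>s. \<Sum>k<n. coord (gradient n f (x + s *\<^sub>R v)) k * coord w k) =
      (\<lambda>s. inner (gradient n f (x + s *\<^sub>R v)) w)"
    by (simp add: inner_Rn[OF gradient_in_Rn[OF f xt]])
  also have "(\<Sum>k<n. inner (gradient n (\<lambda>z. coord (gradient n f z) k) (x + t *\<^sub>R v)) v * coord w k) =
      inner (mat_vec n (hessian n f (x + t *\<^sub>R v)) v) w"
    using has_gradient_coord_gradient[OF f xt]
    by (auto simp: inner_Rn[OF mat_vec_in_Rn] coord_mat_vec hessian_def has_gradient_def inner_Rn intro!: sum.cong)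
  finally show ?thesis .
qed

section \<open>Taylor estimates and finite-difference errors\<close>

lemma le_of_derivative_le_power:
  fixes f :: "real \<Rightarrow> real"
  assumes f: "\<And>t. 0 \<le> t \<Longrightarrow> t \<le> 1 \<Longrightarrow> (f has_real_derivative f' t) (at t)"
    and le: "\<And>t. 0 \<le> t \<Longrightarrow> t \<le> 1 \<Longrightarrow> f' t \<le> c * t ^ k"
  shows "f 1 - f 0 \<le> c / (real k + 1)"
proof -
  let ?g = "\<lambda>t. f t - c / (real k + 1) * t ^ Suc k"
  have "?g 1 \<le> ?g 0"
  proof (rule DERIV_nonpos_imp_nonincreasing[of 0 1])
    fix t :: real assume t: "0 \<le> t" "t \<le> 1"
    have "(?g has_real_derivative f' t - c / (real k + 1) * ((1 + real k) * (1 * t ^ k))) (at t)"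
      by (intro DERIV_diff f t DERIV_cmult DERIV_power_Suc DERIV_ident)
    moreover have "c / (real k + 1) * ((1 + real k) * (1 * t ^ k)) = c * t ^ k"
      by (simp add: field_simps)
    ultimately show "\<exists>y. (?g has_real_derivative y) (at t) \<and> y \<le> 0"
      using le[OF t] by (intro exI[of _ "f' t - c * t ^ k"]) simp
  qed simp
  then show ?thesis by simp
qed

lemma abs_le_quotient:
  fixes a b c z :: real
  shows "z = a / b \<Longrightarrow> \<bar>a\<bar> \<le> c \<Longrightarrow> 0 < b \<Longrightarrow> \<bar>z\<bar> \<le> c / b"
  by (simp add: abs_divide divide_right_mono)

locale lipschitz_hessian =
  fixes n :: nat and f :: "fvec \<Rightarrow> real" and L :: real
  assumes C2: "twice_cont_diff n f"
    and lipschitz: "\<And>y z. y \<in> Rn n \<Longrightarrow> z \<in> Rn n \<Longrightarrow>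
      mat_norm n (\<lambda>k l. hessian n f y k l - hessian n f z k l) \<le> L * norm (y - z)"
    and L_nonneg: "0 \<le> L"
begin

abbreviation "grad \<equiv> gradient n f"
abbreviation "hess \<equiv> hessian n f"

lemma hessian_line_le:
  assumes x: "x \<in> Rn n" and v: "v \<in> Rn n" and t: "0 \<le> t"
  shows "norm (mat_vec n (hess (x + t *\<^sub>R v)) v - mat_vec n (hess x) v) \<le> L * t * norm v ^ 2"
proof -
  have "norm (mat_vec n (hess (x + t *\<^sub>R v)) v - mat_vec n (hess x) v) \<le> (L * norm (t *\<^sub>R v)) * norm v"
    unfolding mat_vec_diff[symmetric] using lipschitz[of "x + t *\<^sub>R v" x] x v
    by (intro order_trans[OF norm_mat_vec_le] mult_right_mono) (auto intro: Rn_intros)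
  then show ?thesis using t by (simp add: power2_eq_square mult_ac)
qed

lemma gradient_taylor:
  assumes x: "x \<in> Rn n" and v: "v \<in> Rn n"
  shows "norm (grad (x + v) - grad x - mat_vec n (hess x) v) \<le> L / 2 * norm v ^ 2"
proof -
  \<comment> \<open>Pairing with the error vector itself reduces the vector estimate to a scalar
    one: \<open>inner w w\<close> is bounded by a multiple of \<open>norm w\<close>, and one factor
    \<open>norm w\<close> cancels.\<close>
  define w where "w = grad (x + v) - grad x - mat_vec n (hess x) v"
  let ?f = "\<lambda>t. inner (grad (x + t *\<^sub>R v)) w - t * inner (mat_vec n (hess x) v) w"
  have "?f 1 - ?f 0 \<le> (L * norm v ^ 2 * norm w) / (real 1 + 1)"
  proof (rule le_of_derivative_le_power[where f = ?f and k = 1])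
    fix t :: real assume t: "0 \<le> t" "t \<le> 1"
    show "(?f has_real_derivative inner (mat_vec n (hess (x + t *\<^sub>R v)) v) w - inner (mat_vec n (hess x) v) w) (at t)"
      by (auto intro!: derivative_eq_intros gradient_line[OF C2 x v])
    have "inner (mat_vec n (hess (x + t *\<^sub>R v)) v) w - inner (mat_vec n (hess x) v) w
        \<le> norm (mat_vec n (hess (x + t *\<^sub>R v)) v - mat_vec n (hess x) v) * norm w"
      unfolding inner_diff_left[symmetric] by (rule norm_cauchy_schwarz)
    also have "\<dots> \<le> (L * t * norm v ^ 2) * norm w"
      by (intro mult_right_mono hessian_line_le x v t) simp
    finally show "inner (mat_vec n (hess (x + t *\<^sub>R v)) v) w - inner (mat_vec n (hess x) v) w
        \<le> L * (norm v)\<^sup>2 * norm w * t ^ 1"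
      by (simp add: mult_ac)
  qed
  moreover have "?f 1 - ?f 0 = inner w w"
    unfolding w_def by (simp add: inner_diff_left)
  ultimately have "norm w * norm w \<le> (L / 2 * norm v ^ 2) * norm w"
    by (simp add: power2_norm_eq_inner[symmetric] power2_eq_square)
  then have "norm w \<le> L / 2 * norm v ^ 2"
    using L_nonneg by (cases "w = 0") auto
  then show ?thesis by (simp add: w_def)
qed

definition remainder :: "fvec \<Rightarrow> fvec \<Rightarrow> real" where
  "remainder x v = f (x + v) - f x - inner (grad x) v - inner (mat_vec n (hess x) v) v / 2"

text \<open>Along the segment the remainder has as derivative the first-order error of the gradient
  paired with \<open>v\<close>, which \<open>gradient_taylor\<close> bounds by a multiple of
  \<open>t ^ 2\<close>.\<close>

lemma taylor:
  assumes x: "x \<in> Rn n" and v: "v \<in> Rn n"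
  shows "\<bar>remainder x v\<bar> \<le> L / 6 * norm v ^ 3"
proof -
  define Hv where "Hv = mat_vec n (hess x) v"
  let ?f = "\<lambda>t. f (x + t *\<^sub>R v) - t * inner (grad x) v - t ^ 2 / 2 * inner Hv v"
  let ?f' = "\<lambda>t. inner (grad (x + t *\<^sub>R v)) v - inner (grad x) v - t * inner Hv v"
  have deriv: "(?f has_real_derivative ?f' t) (at t)" for t
  proof -
    have "x + t *\<^sub>R v \<in> Rn n" using x v by (auto intro: Rn_intros)
    from has_gradient_line[OF has_gradient_gradient[OF C2 this] x v]
    show ?thesis by (auto intro!: derivative_eq_intros)
  qed
  have bound: "\<bar>?f' t\<bar> \<le> (L / 2 * norm v ^ 3) * t ^ 2" for t
  proof -
    have "\<bar>?f' t\<bar> = \<bar>inner (grad (x + t *\<^sub>R v) - grad x - mat_vec n (hess x) (t *\<^sub>R v)) v\<bar>"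
      unfolding Hv_def by (simp add: inner_diff_left linear_cmul[OF linear_mat_vec])
    also have "\<dots> \<le> (L / 2 * norm (t *\<^sub>R v) ^ 2) * norm v"
      using v by (intro order_trans[OF Cauchy_Schwarz_ineq2] mult_right_mono gradient_taylor x) (auto intro: Rn_intros)
    finally show ?thesis by (simp add: power2_eq_square power3_eq_cube mult_ac)
  qed
  have "?f 1 - ?f 0 \<le> (L / 2 * norm v ^ 3) / (real 2 + 1)"
    by (rule le_of_derivative_le_power[where f = ?f, OF deriv]) (rule abs_le_D1[OF bound])
  moreover have "(\<lambda>t. - ?f t) 1 - (\<lambda>t. - ?f t) 0 \<le> (L / 2 * norm v ^ 3) / (real 2 + 1)"
    by (rule le_of_derivative_le_power[where f = "\<lambda>t. - ?f t", OF DERIV_minus[OF deriv]])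
      (rule abs_le_D2[OF bound])
  ultimately show ?thesis
    by (intro abs_leI) (simp_all add: remainder_def Hv_def)
qed

lemma taylor_le:
  assumes "x \<in> Rn n" "v \<in> Rn n" "norm v \<le> a"
  shows "\<bar>remainder x v\<bar> \<le> L / 6 * a ^ 3"
  by (rule order_trans[OF taylor]) (use assms L_nonneg in \<open>auto intro!: mult_left_mono power_mono\<close>)

text \<open>\<open>f (x + v + w)\<close> is expanded once from \<open>x\<close> in the direction
  \<open>v + w\<close> and once through \<open>x + v\<close>. Up to cubic terms the expansions
  differ only in the mixed part: the average of \<open>Q x v w\<close> and \<open>Q x w v\<close> in
  the first, \<open>Q x v w\<close> alone in the second.\<close>

lemma hessian_asymmetry_le:
  assumes x: "x \<in> Rn n" and v: "v \<in> Rn n" and w: "w \<in> Rn n" and le: "norm v \<le> r" "norm w \<le> r"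
  shows "inner (mat_vec n (hess x) v) w - inner (mat_vec n (hess x) w) v \<le> 6 * L * r ^ 3"
proof -
  have r: "0 \<le> r" using le norm_ge_zero order_trans by blast
  have xv: "x + v \<in> Rn n" using x v by (auto intro: Rn_intros)
  define Q where "Q = (\<lambda>y a b. inner (mat_vec n (hess y) a) b)"
  have Q_add: "Q x (v + w) (v + w) = Q x v v + Q x w w + Q x v w + Q x w v"
    by (simp add: Q_def linear_add[OF linear_mat_vec] inner_add_left inner_add_right)
  define D where "D = inner (grad (x + v) - grad x - mat_vec n (hess x) v) w"
  have D_eq: "inner (grad (x + v)) w = inner (grad x) w + Q x v w + D"
    by (simp add: D_def Q_def inner_diff_left)
  have "\<bar>D\<bar> \<le> (L / 2 * r ^ 2) * r"
    unfolding D_def using L_nonneg le r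
    by (intro order_trans[OF Cauchy_Schwarz_ineq2] mult_mono order_trans[OF gradient_taylor[OF x v]])
      (auto intro!: mult_left_mono power_mono)
  then have D: "\<bar>D\<bar> \<le> L / 2 * r ^ 3" by (simp add: power2_eq_square power3_eq_cube mult_ac)
  have "\<bar>Q (x + v) w w - Q x w w\<bar> \<le> ((L * r) * r) * r"
  proof -
    have "\<bar>Q (x + v) w w - Q x w w\<bar> =
        \<bar>inner (mat_vec n (\<lambda>k l. hess (x + v) k l - hess x k l) w) w\<bar>"
      by (simp add: Q_def mat_vec_diff inner_diff_left)
    also have "\<dots> \<le> ((L * norm (x + v - x)) * norm w) * norm w"
      using lipschitz[OF xv x]
      by (intro order_trans[OF Cauchy_Schwarz_ineq2] mult_right_mono order_trans[OF norm_mat_vec_le]) auto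
    also have "\<dots> \<le> ((L * r) * r) * r"
      using le L_nonneg r by (intro mult_mono) auto
    finally show ?thesis .
  qed
  then have Q: "\<bar>Q (x + v) w w - Q x w w\<bar> \<le> L * r ^ 3" by (simp add: power3_eq_cube mult_ac)
  have "f (x + v + w) = f x + inner (grad x) v + inner (grad x) w
      + (Q x v v + Q x w w + Q x v w + Q x w v) / 2 + remainder x (v + w)"
    unfolding Q_add[symmetric] by (simp add: remainder_def Q_def add.assoc inner_add_right)
  moreover have "f (x + v + w) = f x + inner (grad x) v + Q x v v / 2 + remainder x v
      + (inner (grad x) w + Q x v w + D) + Q (x + v) w w / 2 + remainder (x + v) w"
    unfolding D_eq[symmetric] by (simp add: remainder_def Q_def)
  ultimately have "(Q x v w - Q x w v) / 2 =
      remainder x (v + w) - remainder x v - remainder (x + v) w - D - (Q (x + v) w w - Q x w w) / 2"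
    by (simp add: field_simps)
  moreover have "norm (v + w) \<le> 2 * r" using norm_triangle_ineq[of v w] le by simp
  then have "\<bar>remainder x (v + w)\<bar> \<le> L / 6 * (2 * r) ^ 3"
    using v w by (intro taylor_le x) (auto intro: Rn_intros)
  moreover have "\<bar>remainder x v\<bar> \<le> L / 6 * r ^ 3" "\<bar>remainder (x + v) w\<bar> \<le> L / 6 * r ^ 3"
    by (intro taylor_le x xv v w le)+
  \<comment> \<open>In units of \<open>L * r ^ 3\<close> the remainders contribute 8/6, 1/6 and 1/6,
    while \<open>D\<close> and half the Hessian change contribute 1/2 each; the total 8/3 is rounded
    up to 3.\<close>
  ultimately have "(Q x v w - Q x w v) / 2 \<le> 3 * (L * r ^ 3)"
    using D Q by (simp add: power_mult_distrib) argo
  then show ?thesis by (simp add: Q_def)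
qed

text \<open>For directions scaled by \<open>r\<close> the asymmetry is proportional to
  \<open>r ^ 2\<close> but bounded by a multiple of \<open>r ^ 3\<close>; letting \<open>r\<close>
  tend to 0 removes it.\<close>

lemma hessian_symmetric:
  assumes x: "x \<in> Rn n" and k: "k < n" and l: "l < n"
  shows "hess x k l = hess x l k"
proof -
  have le: "hess x k l - hess x l k \<le> 0" if k: "k < n" and l: "l < n" for k l
  proof (rule field_le_epsilon)
    fix e :: real assume e: "0 < e"
    define r where "r = e / (6 * L + 1)"
    have r: "0 < r" using e L_nonneg by (simp add: r_def)
    have "inner (mat_vec n (hess x) (r *\<^sub>R unit_vec l)) (r *\<^sub>R unit_vec k)
        - inner (mat_vec n (hess x) (r *\<^sub>R unit_vec k)) (r *\<^sub>R unit_vec l) \<le> 6 * L * r ^ 3"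
      using k l r by (intro hessian_asymmetry_le x Rn_intros) auto
    then have "r ^ 2 * (hess x k l - hess x l k) \<le> r ^ 2 * (6 * L * r)"
      by (simp add: linear_cmul[OF linear_mat_vec] inner_mat_vec_unit_vec k l power2_eq_square
        power3_eq_cube algebra_simps)
    then have "hess x k l - hess x l k \<le> 6 * L * r" using r by simp
    also have "\<dots> \<le> e" using e L_nonneg by (simp add: r_def field_simps)
    finally show "hess x k l - hess x l k \<le> 0 + e" by simp
  qed
  from le[OF k l] le[OF l k] show ?thesis by simp
qed

section \<open>Errors of the finite-difference gradient and Hessian\<close>

lemma fd_gradient_in_Rn: "fd_gradient n f h x \<in> Rn n"
  unfolding fd_gradient_def by (intro Rn_sum Rn_scaleR unit_vec_in_Rn) simp

text \<open>The constant and quadratic Taylor terms cancel in a central difference, so each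
  coordinate is off by two cubic remainders divided by \<open>2 * h\<close>.\<close>

lemma fd_gradient_error:
  assumes x: "x \<in> Rn n" and h: "0 < h"
  shows "norm (fd_gradient n f h x - grad x) \<le> sqrt n * (L / 6 * h ^ 2)"
proof (rule norm_le_of_coord_le)
  fix k assume k: "k < n"
  let ?v = "h *\<^sub>R unit_vec k"
  have v: "?v \<in> Rn n" "- ?v \<in> Rn n" using k by (auto intro: Rn_intros)
  have "f (x + ?v) - f (x - ?v) = 2 * inner (grad x) ?v + (remainder x ?v - remainder x (- ?v))"
    by (simp add: remainder_def linear_neg[OF linear_mat_vec])
  then have "coord (fd_gradient n f h x - grad x) k = (remainder x ?v - remainder x (- ?v)) / (2 * h)"
    using h k by (simp add: fd_gradient_def inner_unit_vec if_distrib field_simps cong: if_cong)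
  moreover have "\<bar>remainder x ?v\<bar> \<le> L / 6 * h ^ 3" "\<bar>remainder x (- ?v)\<bar> \<le> L / 6 * h ^ 3"
    using taylor_le[OF x v(1), of h] taylor_le[OF x v(2), of h] h by simp_all
  then have "\<bar>remainder x ?v - remainder x (- ?v)\<bar> \<le> L / 3 * h ^ 3" by argo
  ultimately have "\<bar>coord (fd_gradient n f h x - grad x) k\<bar> \<le> L / 3 * h ^ 3 / (2 * h)"
    by (rule abs_le_quotient) (use h in simp)
  also have "\<dots> = L / 6 * h ^ 2"
    using h by (simp add: power2_eq_square power3_eq_cube)
  finally show "\<bar>coord (fd_gradient n f h x - grad x) k\<bar> \<le> L / 6 * h ^ 2" .
qed (use L_nonneg C2 x in \<open>auto intro!: Rn_diff fd_gradient_in_Rn gradient_in_Rn\<close>)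

text \<open>In both schemes the first-order terms cancel and only the mixed second-order terms
  survive; \<open>hessian_symmetric\<close> identifies the two of them. The constants 4/3 and 5/3 so
  obtained are rounded up to a common 2.\<close>

lemma fd_matrix_error:
  assumes x: "x \<in> Rn n" and h: "0 < h" and k: "k < n" and l: "l < n"
  shows "\<bar>fd_matrix s f h x k l - hess x k l\<bar> \<le> 2 * L * h"
proof -
  define Q where "Q = (\<lambda>a b. inner (mat_vec n (hess x) a) b)"
  let ?k = "h *\<^sub>R unit_vec k" and ?l = "h *\<^sub>R unit_vec l"
  have Q: "Q ?k ?l = h ^ 2 * hess x k l" "Q ?l ?k = h ^ 2 * hess x k l"
    unfolding Q_def using hessian_symmetric[OF x k l]
    by (simp_all add: linear_cmul[OF linear_mat_vec] inner_mat_vec_unit_vec k l power2_eq_square)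
  note linear = linear_add[OF linear_mat_vec] linear_diff[OF linear_mat_vec] linear_neg[OF linear_mat_vec]
  have f_eq: "f (x + v) = f x + inner (grad x) v + Q v v / 2 + remainder x v" for v
    by (simp add: remainder_def Q_def)
  have Q_add: "Q (a + b) (a + b) = Q a a + Q a b + Q b a + Q b b"
    and Q_diff: "Q (a - b) (a - b) = Q a a - Q a b - Q b a + Q b b"
    and Q_minus: "Q (- a) (- a) = Q a a" for a b
    by (simp_all add: Q_def linear inner_add_left inner_add_right inner_diff_left inner_diff_right)
  have in_Rn: "?k \<in> Rn n" "?l \<in> Rn n" "?k + ?l \<in> Rn n" "?k - ?l \<in> Rn n" "?l - ?k \<in> Rn n" "- (?k + ?l) \<in> Rn n"
    using k l by (auto intro: Rn_add Rn_diff Rn_minus Rn_scaleR unit_vec_in_Rn simp del: minus_add_distrib)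
  \<comment> \<open>The triangle inequality covers \<open>k = l\<close> as well, where the two
    directions are parallel and \<open>2 * h\<close> is attained.\<close>
  have norms: "norm ?k \<le> h" "norm ?l \<le> h" "norm (?k + ?l) \<le> 2 * h" "norm (?k - ?l) \<le> 2 * h"
    "norm (?l - ?k) \<le> 2 * h" "norm (- (?k + ?l)) \<le> 2 * h"
    using norm_triangle_ineq[of ?k ?l] norm_triangle_ineq4[of ?k ?l] norm_triangle_ineq4[of ?l ?k] h
    unfolding norm_minus_cancel by simp_all
  show ?thesis
  proof (cases s)
    case Central
    have "f (x + (?k + ?l)) - f (x + (?k - ?l)) - f (x + (?l - ?k)) + f (x + - (?k + ?l)) =
        2 * (Q ?k ?l + Q ?l ?k)
        + (remainder x (?k + ?l) - remainder x (?k - ?l) - remainder x (?l - ?k) + remainder x (- (?k + ?l)))"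
      unfolding f_eq Q_add Q_diff Q_minus inner_add_right inner_diff_right inner_minus_right by argo
    then have "fd_matrix s f h x k l - hess x k l =
        (remainder x (?k + ?l) - remainder x (?k - ?l) - remainder x (?l - ?k) + remainder x (- (?k + ?l))) / (4 * h ^ 2)"
      unfolding Q using h by (simp add: Central scaleR_add_right scaleR_diff_right field_simps)
    moreover have "\<bar>remainder x (?k + ?l) - remainder x (?k - ?l) - remainder x (?l - ?k) + remainder x (- (?k + ?l))\<bar>
        \<le> 4 * (L / 6 * (2 * h) ^ 3)"
      using taylor_le[OF x in_Rn(3) norms(3)] taylor_le[OF x in_Rn(4) norms(4)]
        taylor_le[OF x in_Rn(5) norms(5)] taylor_le[OF x in_Rn(6) norms(6)] by argo
    ultimately have "\<bar>fd_matrix s f h x k l - hess x k l\<bar> \<le> 4 * (L / 6 * (2 * h) ^ 3) / (4 * h ^ 2)"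
      by (rule abs_le_quotient) (use h in simp)
    also have "\<dots> = 4 / 3 * L * h"
      using h by (simp add: field_simps power2_eq_square power3_eq_cube)
    also have "\<dots> \<le> 2 * L * h" using h L_nonneg by simp
    finally show ?thesis .
  next
    case Forward
    have "f (x + (?k + ?l)) - f (x + ?k) - f (x + ?l) + f x =
        (Q ?k ?l + Q ?l ?k) / 2 + (remainder x (?k + ?l) - remainder x ?k - remainder x ?l)"
      unfolding f_eq Q_add Q_diff Q_minus inner_add_right inner_diff_right inner_minus_right by argo
    then have "fd_matrix s f h x k l - hess x k l =
        (remainder x (?k + ?l) - remainder x ?k - remainder x ?l) / h ^ 2"
      unfolding Q using h by (simp add: Forward scaleR_add_right field_simps)
    moreover have "\<bar>remainder x (?k + ?l) - remainder x ?k - remainder x ?l\<bar>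
        \<le> L / 6 * (2 * h) ^ 3 + 2 * (L / 6 * h ^ 3)"
      using taylor_le[OF x in_Rn(1) norms(1)] taylor_le[OF x in_Rn(2) norms(2)]
        taylor_le[OF x in_Rn(3) norms(3)] by argo
    ultimately have "\<bar>fd_matrix s f h x k l - hess x k l\<bar> \<le> (L / 6 * (2 * h) ^ 3 + 2 * (L / 6 * h ^ 3)) / h ^ 2"
      by (rule abs_le_quotient) (use h in simp)
    also have "\<dots> = 5 / 3 * L * h"
      using h by (simp add: field_simps power2_eq_square power3_eq_cube)
    also have "\<dots> \<le> 2 * L * h" using h L_nonneg by simp
    finally show ?thesis .
  qed
qed

lemma fd_hessian_error:
  assumes x: "x \<in> Rn n" and h: "0 < h" and v: "v \<in> Rn n"
  shows "norm (mat_vec n (fd_hessian s f h x) v - mat_vec n (hess x) v) \<le> n * (2 * L * h) * norm v"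
  unfolding mat_vec_diff[symmetric]
proof (rule norm_mat_vec_le_of_entries[OF _ v])
  fix k l assume "k < n" "l < n"
  then show "\<bar>fd_hessian s f h x k l - hess x k l\<bar> \<le> 2 * L * h"
    using fd_matrix_error[OF x h, of k l s] fd_matrix_error[OF x h, of l k s] hessian_symmetric[OF x, of k l]
    by (simp add: fd_hessian_def) argo
qed (use L_nonneg h in simp)

end

section \<open>Gradient of the cubic model\<close>

lemma fd_hessian_symmetric: "fd_hessian s f h x k l = fd_hessian s f h x l k"
  by (simp add: fd_hessian_def add.commute)

text \<open>At \<open>y \<noteq> x\<close> the norm is differentiable and the chain rule applies.
  Symmetry of \<open>H\<close> merges the two terms of the derivative of the quadratic form and
  cancels the factor 1/2.\<close>

lemma gradient_cubic_model:
  assumes x: "x \<in> Rn n" and y: "y \<in> Rn n" and "y \<noteq> x" and g: "g \<in> Rn n"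
    and sym: "\<And>k l. k < n \<Longrightarrow> l < n \<Longrightarrow> H k l = H l k"
  shows "gradient n (cubic_model n g H \<sigma> x) y = g + mat_vec n H (y - x) + (\<sigma> / 2 * norm (y - x)) *\<^sub>R (y - x)"
    (is "_ = ?g")
proof (rule gradient_eq[OF y])
  have "?g \<in> Rn n" using x y g by (auto intro!: Rn_intros mat_vec_in_Rn)
  moreover have "(cubic_model n g H \<sigma> x has_derivative inner ?g) (at y within Rn n)"
  proof (rule has_derivative_eq_rhs)
    have diff: "((\<lambda>z. z - x) has_derivative (\<lambda>v. v)) (at y within Rn n)"
      by (auto intro!: derivative_eq_intros)
    note norm = has_derivative_compose[OF diff has_derivative_norm]
    note quad = has_derivative_inner[OF bounded_linear.has_derivative[OF bounded_linear_mat_vec diff] diff]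
    show "(cubic_model n g H \<sigma> x has_derivative (\<lambda>v. inner g v
        + 1 / 2 * (inner (mat_vec n H (y - x)) v + inner (mat_vec n H v) (y - x))
        + \<sigma> / 6 * (of_nat 3 * inner v (sgn (y - x)) * norm (y - x) ^ (3 - 1)))) (at y within Rn n)"
      unfolding cubic_model_def[abs_def]
      by (intro has_derivative_add has_derivative_inner_right has_derivative_mult_right
          has_derivative_power diff norm quad) (use \<open>y \<noteq> x\<close> in simp)
    have sym: "inner (mat_vec n H v) (y - x) = inner (mat_vec n H (y - x)) v" for v
      using inner_mat_vec_symmetric[OF sym] .
    show "(\<lambda>v. inner g v + 1 / 2 * (inner (mat_vec n H (y - x)) v + inner (mat_vec n H v) (y - x))
        + \<sigma> / 6 * (of_nat 3 * inner v (sgn (y - x)) * norm (y - x) ^ (3 - 1))) = inner ?g"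
    proof
      fix v
      have "inner v (sgn (y - x)) * norm (y - x) ^ 2 = norm (y - x) * inner (y - x) v"
        using \<open>y \<noteq> x\<close> by (simp add: sgn_div_norm inner_commute power2_eq_square)
      then show "inner g v + 1 / 2 * (inner (mat_vec n H (y - x)) v + inner (mat_vec n H v) (y - x))
        + \<sigma> / 6 * (of_nat 3 * inner v (sgn (y - x)) * norm (y - x) ^ (3 - 1)) = inner ?g v"
        by (simp add: sym inner_add_left mult.assoc)
    qed
  qed
  ultimately show "has_gradient n (cubic_model n g H \<sigma> x) ?g y"
    by (simp add: has_gradient_def)
qed

section \<open>One inner iteration\<close>

lemma length_evaluation_points: "length (evaluation_points s n h x y) = 2 * n + 4 * n ^ 2 + 2"
proof -
  have "length (entry_points s h x k l) = 4" for k l by (cases s) simp_all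
  then show ?thesis
    by (simp add: evaluation_points_def gradient_points_def hessian_points_def length_concat comp_def
      sum_list_triv power2_eq_square)
qed

lemma iteration_evals_eq: "iteration_evals n m \<beta> \<alpha> S c y = m * (2 * n + 4 * n ^ 2 + 2)"
  by (simp add: iteration_evals_def length_evaluation_points)

lemma alg_step_cases:
  assumes "alg_step n m F \<beta> \<sigma>1 \<theta> \<alpha> c c'"
  obtains (accept) S y w where
      "trial_ok n m F \<beta> \<theta> \<alpha> S c y w" "sufficient_decrease m F \<alpha> c y"
      "outer_idx c' = outer_idx c + 1" "x_prev c' = x_cur c" "x_cur c' = y"
      "sigma_cur c' = \<alpha> powi (int (inner_idx c) - 1) * sigma_cur c"
      "inner_idx c' = first_inner \<alpha> \<sigma>1 (sigma_cur c')"
      "evals c' = evals c + m * (2 * n + 4 * n ^ 2 + 2)"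
  | (reject) S y w where
      "trial_ok n m F \<beta> \<theta> \<alpha> S c y w" "\<not> sufficient_decrease m F \<alpha> c y"
      "outer_idx c' = outer_idx c" "x_prev c' = x_prev c" "x_cur c' = x_cur c"
      "sigma_cur c' = sigma_cur c" "inner_idx c' = inner_idx c + 1"
      "evals c' = evals c + m * (2 * n + 4 * n ^ 2 + 2)"
  using assms by (cases rule: alg_step.cases) (auto simp: iteration_evals_eq)

text \<open>A Young-type inequality, used to split the mixed error terms \<open>r ^ 2 * s\<close>
  and \<open>r * s ^ 2\<close> into pure cubes of consecutive step lengths.\<close>

lemma power2_mult_le_cubes:
  fixes a b :: real
  assumes "0 \<le> a" "0 \<le> b"
  shows "a ^ 2 * b \<le> a ^ 3 + b ^ 3"
proof (cases "b \<le> a")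
  case True
  then have "a ^ 2 * b \<le> a ^ 2 * a" by (intro mult_left_mono) auto
  also have "\<dots> = a ^ 3" by (simp add: power2_eq_square power3_eq_cube)
  finally show ?thesis using assms zero_le_power[of b 3] by linarith
next
  case False
  then have "a ^ 2 * b \<le> b ^ 2 * b" using assms by (intro mult_right_mono power_mono) auto
  also have "\<dots> = b ^ 3" by (simp add: power2_eq_square power3_eq_cube)
  finally show ?thesis using assms zero_le_power[of a 3] by linarith
qed

section \<open>Scale factors, stepsize and model accuracy\<close>

locale cubic_method =
  fixes n m :: nat and F :: "nat \<Rightarrow> fvec \<Rightarrow> real" and L \<beta> \<sigma>1 \<theta> \<alpha> :: real
  assumes n_pos: "1 \<le> n" and m_pos: "1 \<le> m"
    and F: "\<And>j. j < m \<Longrightarrow> lipschitz_hessian n (F j) L"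
    and \<beta>: "0 \<le> \<beta>" "\<beta> \<le> 1" and \<sigma>1: "0 < \<sigma>1" and \<theta>: "0 \<le> \<theta>" and \<alpha>: "1 < \<alpha>"
begin

lemma L_nonneg: "0 \<le> L"
  using lipschitz_hessian.L_nonneg[OF F[of 0]] m_pos by simp

definition dimfac :: real where "dimfac = real n powr (1 - \<beta>)"

text \<open>The condition \<open>\<beta> \<le> 1\<close> enters here; it allows dimension-free terms
  to be enlarged to multiples of \<open>dimfac\<close>.\<close>

lemma dimfac_ge_1: "1 \<le> dimfac"
  using n_pos \<beta> by (simp add: dimfac_def ge_one_powr_ge_zero)

lemma n_eq_dimfac: "real n = dimfac * real n powr \<beta>"
  using n_pos by (simp add: dimfac_def powr_add[symmetric])

text \<open>The factor that acceptance would apply to \<open>sigma_cur\<close>. The integer power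
  accommodates the exponent -1 at inner index 0.\<close>

definition incr :: "alg_state \<Rightarrow> real" where
  "incr st = \<alpha> powi (int (inner_idx st) - 1)"

lemma incr_eq: "incr st = \<alpha> ^ inner_idx st / \<alpha>"
  using \<alpha> by (simp add: incr_def power_int_diff)

lemma incr_pos: "0 < incr st"
  using \<alpha> by (simp add: incr_eq)

lemma inverse_incr_le: "1 / incr st \<le> \<alpha>"
  using \<alpha> by (simp add: incr_eq divide_le_eq)

lemma incr_mult_le:
  assumes "inner_idx st \<le> 1" "0 \<le> \<sigma>"
  shows "incr st * \<sigma> \<le> \<sigma>"
proof -
  have "incr st \<le> 1" using \<alpha> assms(1) by (cases "inner_idx st") (simp_all add: incr_eq)
  then show ?thesis using assms(2) mult_right_mono[of "incr st" 1 \<sigma>] by simp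
qed

abbreviation radius :: "alg_state \<Rightarrow> real" where
  "radius st \<equiv> norm (x_cur st - x_prev st)"

text \<open>Each entry of the minimum serves one error: the bound on the square controls the
  gradient error, the linear bound the Hessian error.\<close>

lemma stepsize_bounds:
  assumes "x_cur st \<noteq> x_prev st"
  defines "q \<equiv> real n powr \<beta> * incr st"
  shows "0 < stepsize n \<beta> \<alpha> st"
    and "stepsize n \<beta> \<alpha> st ^ 2 \<le> 6 / q * radius st ^ 2"
    and "stepsize n \<beta> \<alpha> st \<le> 3 / (2 * q) * radius st"
proof -
  have q: "0 < q" using n_pos incr_pos[of st] by (simp add: q_def)
  have h: "stepsize n \<beta> \<alpha> st = min (sqrt 6 / sqrt q) (3 / (2 * q)) * radius st"
    by (simp add: stepsize_def q_def incr_def Let_def)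
  show pos: "0 < stepsize n \<beta> \<alpha> st" using assms(1) q by (simp add: h)
  show "stepsize n \<beta> \<alpha> st \<le> 3 / (2 * q) * radius st"
    unfolding h by (intro mult_right_mono) auto
  have "stepsize n \<beta> \<alpha> st \<le> sqrt 6 / sqrt q * radius st"
    unfolding h by (intro mult_right_mono) auto
  then have "stepsize n \<beta> \<alpha> st ^ 2 \<le> (sqrt 6 / sqrt q * radius st) ^ 2"
    using pos by (intro power_mono) auto
  also have "\<dots> = 6 / q * radius st ^ 2"
    using q by (simp add: power_mult_distrib power_divide)
  finally show "stepsize n \<beta> \<alpha> st ^ 2 \<le> 6 / q * radius st ^ 2" .
qed

text \<open>A common unit for both errors: with \<open>r = radius st\<close>, the gradient is off by
  one unit times \<open>r ^ 2\<close>, the Hessian by three units times \<open>r\<close>.\<close>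

definition fdiff_error :: "alg_state \<Rightarrow> real" where
  "fdiff_error st = L * dimfac / incr st"

lemma fdiff_error_nonneg: "0 \<le> fdiff_error st"
  using L_nonneg dimfac_ge_1 incr_pos[of st] by (simp add: fdiff_error_def)

lemma fdiff_error_le: "fdiff_error st \<le> \<alpha> * L * dimfac"
  using mult_left_mono[OF inverse_incr_le[of st], of "L * dimfac"] L_nonneg dimfac_ge_1
  by (simp add: fdiff_error_def mult_ac)

context
  fixes st :: alg_state
  assumes x: "x_cur st \<in> Rn n" and neq: "x_cur st \<noteq> x_prev st"
begin

abbreviation "h \<equiv> stepsize n \<beta> \<alpha> st"

lemma gradient_error:
  assumes j: "j < m"
  shows "norm (fd_gradient n (F j) h (x_cur st) - gradient n (F j) (x_cur st)) \<le> fdiff_error st * radius st ^ 2"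
proof -
  note h = stepsize_bounds[OF neq]
  have "norm (fd_gradient n (F j) h (x_cur st) - gradient n (F j) (x_cur st)) \<le> sqrt n * (L / 6 * h ^ 2)"
    by (rule lipschitz_hessian.fd_gradient_error[OF F[OF j] x h(1)])
  \<comment> \<open>Weakening \<open>sqrt n\<close> to \<open>n\<close> gives gradient and Hessian
    the same unit; of \<open>n = dimfac * n powr \<beta>\<close> the second factor then cancels
    against the stepsize.\<close>
  also have "\<dots> \<le> n * (L / 6 * (6 / (real n powr \<beta> * incr st) * radius st ^ 2))"
    using h(2) L_nonneg n_pos by (intro mult_mono mult_left_mono) (auto simp: real_sqrt_le_iff' power2_eq_square)
  also have "\<dots> = fdiff_error st * radius st ^ 2"
    using n_pos by (subst n_eq_dimfac) (simp add: fdiff_error_def)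
  finally show ?thesis .
qed

lemma hessian_error:
  assumes j: "j < m" and v: "v \<in> Rn n"
  shows "norm (mat_vec n (fd_hessian s (F j) h (x_cur st)) v - mat_vec n (hessian n (F j) (x_cur st)) v)
    \<le> 3 * fdiff_error st * radius st * norm v"
proof -
  note h = stepsize_bounds[OF neq]
  have "norm (mat_vec n (fd_hessian s (F j) h (x_cur st)) v - mat_vec n (hessian n (F j) (x_cur st)) v)
      \<le> n * (2 * L * h) * norm v"
    by (rule lipschitz_hessian.fd_hessian_error[OF F[OF j] x h(1) v])
  also have "\<dots> \<le> n * (2 * L * (3 / (2 * (real n powr \<beta> * incr st)) * radius st)) * norm v"
    using h(3) L_nonneg by (intro mult_right_mono mult_left_mono) auto
  also have "\<dots> = 3 * fdiff_error st * radius st * norm v"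
    using n_pos by (subst n_eq_dimfac) (simp add: fdiff_error_def)
  finally show ?thesis .
qed

text \<open>Taylor expansion of the objective minus the model, whose value at \<open>y\<close> is
  nonpositive: what remains is the finite-difference error, the Taylor remainder and the negative
  cubic term.\<close>

lemma objective_le:
  assumes y: "y \<in> Rn n" and j: "j < m" and model: "alg_model n F \<beta> \<alpha> S st j y \<le> 0"
  defines "s \<equiv> norm (y - x_cur st)" and "r \<equiv> radius st"
  shows "F j y \<le> F j (x_cur st) + fdiff_error st * r ^ 2 * s + 3 / 2 * fdiff_error st * r * s ^ 2
     + L / 6 * s ^ 3 - \<alpha> ^ inner_idx st * sigma_cur st / 6 * s ^ 3"
proof -
  interpret lipschitz_hessian n "F j" L by (rule F[OF j])
  define v where "v = y - x_cur st"
  have v: "v \<in> Rn n" using y x by (auto simp: v_def intro: Rn_intros)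
  define g where "g = fd_gradient n (F j) h (x_cur st)"
  define Hv where "Hv = mat_vec n (fd_hessian (S j) (F j) h (x_cur st)) v"
  have "inner (grad (x_cur st) - g) v \<le> fdiff_error st * r ^ 2 * s"
    using gradient_error[OF j] unfolding g_def r_def s_def v_def
    by (intro order_trans[OF norm_cauchy_schwarz] mult_right_mono) (simp_all add: norm_minus_commute)
  moreover have "inner (mat_vec n (hess (x_cur st)) v - Hv) v \<le> (3 * fdiff_error st * r * s) * s"
    using hessian_error[OF j v] unfolding Hv_def r_def s_def v_def
    by (intro order_trans[OF norm_cauchy_schwarz] mult_right_mono) (simp_all add: norm_minus_commute)
  moreover have "remainder (x_cur st) v \<le> L / 6 * s ^ 3"
    using taylor[OF x v] by (simp add: s_def v_def)
  moreover have "F j y = F j (x_cur st) + inner (grad (x_cur st)) v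
      + inner (mat_vec n (hess (x_cur st)) v) v / 2 + remainder (x_cur st) v"
    by (simp add: remainder_def v_def)
  moreover have "inner g v + inner Hv v / 2 + \<alpha> ^ inner_idx st * sigma_cur st / 6 * s ^ 3 \<le> 0"
    using model by (simp add: alg_model_def Let_def cubic_model_def g_def Hv_def v_def s_def)
  ultimately show ?thesis
    by (simp add: inner_diff_left power2_eq_square algebra_simps)
qed

lemma trial_okD:
  assumes "trial_ok n m F \<beta> \<theta> \<alpha> S st y w"
  shows "y \<in> Rn n" and "\<And>j. j < m \<Longrightarrow> 0 \<le> w j" and "(\<Sum>j<m. w j) = 1"
    and "\<And>j. j < m \<Longrightarrow> alg_model n F \<beta> \<alpha> S st j y \<le> 0"
    and "norm (\<Sum>j<m. w j *\<^sub>R gradient n (alg_model n F \<beta> \<alpha> S st j) y) \<le> \<theta> * norm (y - x_cur st) ^ 2"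
  using assms m_pos unfolding trial_ok_def
  by (auto simp: Max_le_iff lessThan_empty_iff)

lemma sufficient_decreaseI:
  assumes trial: "trial_ok n m F \<beta> \<theta> \<alpha> S st y w"
    and large: "(60 * L + 1) * dimfac \<le> incr st * sigma_cur st"
  shows "sufficient_decrease m F \<alpha> st y"
  unfolding sufficient_decrease_def
proof (intro allI impI)
  fix j assume j: "j < m"
  define E \<sigma> a where "E = fdiff_error st" and "\<sigma> = sigma_cur st" and "a = \<alpha> ^ inner_idx st"
  define s r where "s = norm (y - x_cur st)" and "r = radius st"
  have rs: "0 \<le> r" "0 \<le> s" by (simp_all add: r_def s_def)
  have large': "60 * (L * dimfac) \<le> incr st * \<sigma>" using large dimfac_ge_1 by (simp add: algebra_simps \<sigma>_def)
  then have E: "E \<le> \<sigma> / 60" using incr_pos[of st] by (simp add: E_def fdiff_error_def field_simps)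
  have E0: "0 \<le> E" by (simp add: E_def fdiff_error_nonneg)
  then have \<sigma>: "0 \<le> \<sigma>" using E by simp
  have a: "1 \<le> a" "incr st \<le> a" using \<alpha> by (simp_all add: a_def incr_eq divide_le_eq)
  have "60 * L \<le> 60 * (L * dimfac)" using L_nonneg dimfac_ge_1 mult_left_mono[of 1 dimfac L] by simp
  also note large'
  also have "incr st * \<sigma> \<le> a * \<sigma>" using a \<sigma> by (intro mult_right_mono)
  finally have L: "L \<le> a * \<sigma> / 60" by simp
  have \<sigma>a: "\<sigma> \<le> a * \<sigma>" using a \<sigma> mult_right_mono[of 1 a \<sigma>] by simp
  note young = power2_mult_le_cubes[OF rs] power2_mult_le_cubes[OF rs(2,1)]
  \<comment> \<open>The constant 60 gives \<open>E \<le> \<sigma> / 60\<close> and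
    \<open>L \<le> a * \<sigma> / 60\<close>. Hence \<open>U\<close> is at most
    \<open>(P + Q) / 24\<close> with \<open>Q \<le> R\<close>, and the \<open>R\<close>-terms sum to
    at most 1/24 + 1/360 - 1/6, which is below -1/12.\<close>
  define P Q R U where "P = \<sigma> * r ^ 3" and "Q = \<sigma> * s ^ 3" and "R = a * \<sigma> * s ^ 3"
    and "U = E * r ^ 2 * s + 3 / 2 * E * r * s ^ 2"
  have "F j y \<le> F j (x_cur st) + U + L / 6 * s ^ 3 - R / 6"
    using objective_le[OF trial_okD(1)[OF trial] j trial_okD(4)[OF trial j]]
    by (simp add: E_def a_def \<sigma>_def r_def s_def U_def R_def)
  moreover have "U \<le> 5 / 2 * (E * (r ^ 3 + s ^ 3))"
    using mult_left_mono[OF young(1) E0] mult_left_mono[OF young(2) E0] by (simp add: U_def algebra_simps)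
  moreover have "E * (r ^ 3 + s ^ 3) \<le> P / 60 + Q / 60"
    using mult_right_mono[OF E, of "r ^ 3 + s ^ 3"] rs by (simp add: P_def Q_def algebra_simps add_divide_distrib)
  moreover have "L / 6 * s ^ 3 \<le> R / 360"
    using mult_right_mono[OF L, of "s ^ 3"] rs by (simp add: R_def)
  moreover have "Q \<le> R" using \<sigma>a rs unfolding Q_def R_def by (intro mult_right_mono) auto
  moreover have "0 \<le> R" "0 \<le> P" using rs a \<sigma> by (simp_all add: R_def P_def)
  ultimately have "R / 12 - P / 12 \<le> F j (x_cur st) - F j y" by linarith
  then show "\<alpha> ^ inner_idx st * sigma_cur st / 12 * norm (y - x_cur st) ^ 3
        - sigma_cur st / 12 * radius st ^ 3 \<le> F j (x_cur st) - F j y"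
    by (simp add: R_def P_def a_def \<sigma>_def r_def s_def)
qed

lemma gradient_model_error:
  assumes y: "y \<in> Rn n" "y \<noteq> x_cur st" and j: "j < m" and \<sigma>: "0 \<le> sigma_cur st"
  defines "s \<equiv> norm (y - x_cur st)" and "r \<equiv> radius st"
  shows "norm (gradient n (F j) y - gradient n (alg_model n F \<beta> \<alpha> S st j) y)
    \<le> L / 2 * s ^ 2 + fdiff_error st * r ^ 2 + 3 * fdiff_error st * r * s
      + \<alpha> ^ inner_idx st * sigma_cur st / 2 * s ^ 2"
proof -
  interpret lipschitz_hessian n "F j" L by (rule F[OF j])
  define v where "v = y - x_cur st"
  have v: "v \<in> Rn n" using y x by (auto simp: v_def intro: Rn_intros)
  \<comment> \<open>The discrepancy splits into the Taylor error \<open>a\<close>, the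
    finite-difference errors \<open>b\<close> and \<open>d\<close>, and the gradient
    \<open>z\<close> of the cubic term.\<close>
  define a where "a = grad y - grad (x_cur st) - mat_vec n (hess (x_cur st)) v"
  define b where "b = fd_gradient n (F j) h (x_cur st) - grad (x_cur st)"
  define d where "d = mat_vec n (fd_hessian (S j) (F j) h (x_cur st)) v - mat_vec n (hess (x_cur st)) v"
  define z where "z = (\<alpha> ^ inner_idx st * sigma_cur st / 2 * norm v) *\<^sub>R v"
  have "gradient n (alg_model n F \<beta> \<alpha> S st j) y =
      fd_gradient n (F j) h (x_cur st) + mat_vec n (fd_hessian (S j) (F j) h (x_cur st)) v + z"
    unfolding alg_model_def Let_def v_def z_def
    by (intro gradient_cubic_model x y fd_gradient_in_Rn fd_hessian_symmetric)
  then have "grad y - gradient n (alg_model n F \<beta> \<alpha> S st j) y = a - b - d - z"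
    by (simp add: a_def b_def d_def algebra_simps)
  moreover have "norm (a - b - d - z) \<le> norm a + norm b + norm d + norm z"
    by (meson add_mono norm_triangle_ineq4 order_refl order_trans)
  moreover have "norm a \<le> L / 2 * s ^ 2"
    using gradient_taylor[OF x v] by (simp add: a_def v_def s_def)
  moreover have "norm b \<le> fdiff_error st * r ^ 2"
    using gradient_error[OF j] by (simp add: b_def r_def)
  moreover have "norm d \<le> 3 * fdiff_error st * r * s"
    using hessian_error[OF j v] by (simp add: d_def r_def s_def v_def)
  moreover have "norm z = \<alpha> ^ inner_idx st * sigma_cur st / 2 * s ^ 2"
    using \<sigma> \<alpha> by (simp add: z_def s_def v_def power2_eq_square)
  ultimately show ?thesis by simp
qed

end

end

section \<open>Runs of the algorithm\<close>

text \<open>Index 1, with exponent 0, already meets the defining condition, so the least index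
  exists and is 0 or 1.\<close>

lemma first_inner_props:
  assumes "0 < \<sigma>1" "\<sigma>1 \<le> \<sigma>"
  shows "\<sigma>1 \<le> \<alpha> powi (int (first_inner \<alpha> \<sigma>1 \<sigma>) - 1) * \<sigma>" and "first_inner \<alpha> \<sigma>1 \<sigma> \<le> 1"
proof -
  have *: "\<sigma>1 \<le> \<alpha> powi (int 1 - 1) * \<sigma>" using assms by simp
  show "\<sigma>1 \<le> \<alpha> powi (int (first_inner \<alpha> \<sigma>1 \<sigma>) - 1) * \<sigma>"
    unfolding first_inner_def by (rule LeastI[of "\<lambda>i. \<sigma>1 \<le> \<alpha> powi (int i - 1) * \<sigma>", OF *])
  show "first_inner \<alpha> \<sigma>1 \<sigma> \<le> 1"
    unfolding first_inner_def by (rule Least_le[of "\<lambda>i. \<sigma>1 \<le> \<alpha> powi (int i - 1) * \<sigma>", OF *])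
qed

lemma square_add_mult_le:
  fixes a b :: real
  shows "a ^ 2 + 3 * (a * b) \<le> 4 * (a ^ 2 + b ^ 2)"
proof -
  have "2 * (a * b) \<le> a ^ 2 + b ^ 2" using sum_squares_bound[of a b] by simp
  moreover have "0 \<le> a ^ 2" "0 \<le> b ^ 2" by simp_all
  ultimately show ?thesis by argo
qed

section \<open>The weighted gradient at a trial point\<close>

context cubic_method
begin

text \<open>The larger of the initial parameter and the acceptance threshold of
  \<open>sufficient_decreaseI\<close>, with the factor \<open>dimfac\<close> removed.\<close>

definition sigma_base :: real where "sigma_base = max \<sigma>1 (60 * L + 1)"

lemma sigma_base_pos: "0 < sigma_base"
  using \<sigma>1 by (simp add: sigma_base_def)

definition grad_const :: real where
  "grad_const = \<theta> + L + 4 * \<alpha> * L + \<alpha> ^ 2 * sigma_base + 1"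

lemma grad_const_pos: "0 < grad_const"
  using \<theta> L_nonneg \<alpha> sigma_base_pos by (simp add: grad_const_def add_nonneg_pos)

text \<open>The weights are convex, so an error bound common to all objectives passes to the
  weighted sum; the weighted model gradient adds \<open>\<theta> * s ^ 2\<close>. Each term is then
  enlarged to a multiple of \<open>dimfac * (r ^ 2 + s ^ 2)\<close>.\<close>

lemma trial_gradient_le:
  assumes x: "x_cur st \<in> Rn n" and neq: "x_cur st \<noteq> x_prev st"
    and trial: "trial_ok n m F \<beta> \<theta> \<alpha> S st y w" and y: "y \<noteq> x_cur st"
    and \<sigma>: "0 \<le> sigma_cur st" "incr st * sigma_cur st \<le> \<alpha> * (sigma_base * dimfac)"
  defines "s \<equiv> norm (y - x_cur st)" and "r \<equiv> radius st"
  shows "norm (\<Sum>j<m. w j *\<^sub>R gradient n (F j) y) \<le> grad_const * dimfac * (r ^ 2 + s ^ 2)"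
proof -
  note trial' = trial_okD[OF x neq trial]
  define e E where "e = dimfac" and "E = fdiff_error st"
  let ?M = "alg_model n F \<beta> \<alpha> S st"
  define b where "b = L / 2 * s ^ 2 + E * r ^ 2 + 3 * E * r * s + \<alpha> ^ inner_idx st * sigma_cur st / 2 * s ^ 2"
  have e: "1 \<le> e" by (simp add: e_def dimfac_ge_1)
  have E: "0 \<le> E" "E \<le> \<alpha> * L * e" by (simp_all add: E_def e_def fdiff_error_nonneg fdiff_error_le)
  have "(\<Sum>j<m. w j *\<^sub>R gradient n (F j) y) =
      (\<Sum>j<m. w j *\<^sub>R gradient n (?M j) y) + (\<Sum>j<m. w j *\<^sub>R (gradient n (F j) y - gradient n (?M j) y))"
    by (simp add: scaleR_diff_right sum_subtractf)
  then have "norm (\<Sum>j<m. w j *\<^sub>R gradient n (F j) y) \<le>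
      \<theta> * s ^ 2 + norm (\<Sum>j<m. w j *\<^sub>R (gradient n (F j) y - gradient n (?M j) y))"
    using norm_triangle_mono[OF trial'(5) order_refl] by (simp add: s_def)
  also have "norm (\<Sum>j<m. w j *\<^sub>R (gradient n (F j) y - gradient n (?M j) y)) \<le> (\<Sum>j<m. w j * b)"
  proof (intro order_trans[OF norm_sum] sum_mono)
    fix j assume "j \<in> {..<m}"
    then show "norm (w j *\<^sub>R (gradient n (F j) y - gradient n (?M j) y)) \<le> w j * b"
      using trial'(2)[of j] gradient_model_error[OF x neq trial'(1) y _ \<sigma>(1), of j S]
      by (simp add: b_def E_def r_def s_def mult_left_mono)
  qed
  also have "(\<Sum>j<m. w j * b) = b" using trial'(3) by (simp add: sum_distrib_right[symmetric])
  also have "\<theta> * s ^ 2 + b \<le> \<theta> * e * s ^ 2 + L * e * (r ^ 2 + s ^ 2) + 4 * \<alpha> * L * e * (r ^ 2 + s ^ 2)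
      + \<alpha> ^ 2 * sigma_base * e * s ^ 2"
  proof -
    have "\<theta> * s ^ 2 \<le> \<theta> * e * s ^ 2"
      using e \<theta> mult_left_mono[of 1 e \<theta>] by (intro mult_right_mono) auto
    moreover have "L / 2 * s ^ 2 \<le> L * e * (r ^ 2 + s ^ 2)"
      using e L_nonneg mult_left_mono[of 1 e L] by (intro mult_mono) auto
    moreover have "E * r ^ 2 + 3 * E * r * s \<le> 4 * \<alpha> * L * e * (r ^ 2 + s ^ 2)"
    proof -
      have "r ^ 2 + 3 * (r * s) \<le> 4 * (r ^ 2 + s ^ 2)" by (rule square_add_mult_le)
      then have "E * (r ^ 2 + 3 * (r * s)) \<le> (\<alpha> * L * e) * (4 * (r ^ 2 + s ^ 2))"
        using E by (intro mult_mono) (auto simp: r_def s_def)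
      then show ?thesis by (simp add: algebra_simps)
    qed
    moreover have "\<alpha> ^ inner_idx st * sigma_cur st / 2 * s ^ 2 \<le> \<alpha> ^ 2 * sigma_base * e * s ^ 2"
    proof (rule mult_right_mono)
      \<comment> \<open>Since \<open>\<alpha> ^ inner_idx st\<close> is
        \<open>\<alpha> * incr st\<close>, a second factor \<open>\<alpha>\<close> appears.\<close>
      have "\<alpha> * (incr st * sigma_cur st) \<le> \<alpha> * (\<alpha> * (sigma_base * e))"
        using \<sigma>(2) \<alpha> by (simp add: e_def)
      then have "\<alpha> ^ inner_idx st * sigma_cur st \<le> \<alpha> ^ 2 * sigma_base * e"
        using \<alpha> by (simp add: incr_eq power2_eq_square mult_ac)
      moreover have "0 \<le> \<alpha> ^ inner_idx st * sigma_cur st" using \<alpha> \<sigma>(1) by simp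
      ultimately show "\<alpha> ^ inner_idx st * sigma_cur st / 2 \<le> \<alpha> ^ 2 * sigma_base * e" by linarith
    qed simp
    ultimately show ?thesis unfolding b_def by linarith
  qed
  also have "\<dots> \<le> \<theta> * e * (r ^ 2 + s ^ 2) + L * e * (r ^ 2 + s ^ 2) + 4 * \<alpha> * L * e * (r ^ 2 + s ^ 2)
      + \<alpha> ^ 2 * sigma_base * e * (r ^ 2 + s ^ 2) + e * (r ^ 2 + s ^ 2)"
  proof -
    have "\<theta> * e * s ^ 2 \<le> \<theta> * e * (r ^ 2 + s ^ 2)" using \<theta> e by (intro mult_left_mono) auto
    moreover have "\<alpha> ^ 2 * sigma_base * e * s ^ 2 \<le> \<alpha> ^ 2 * sigma_base * e * (r ^ 2 + s ^ 2)"
      using sigma_base_pos e by (intro mult_left_mono) auto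
    moreover have "0 \<le> e * (r ^ 2 + s ^ 2)" using e by simp
    ultimately show ?thesis by linarith
  qed
  also have "\<dots> = grad_const * e * (r ^ 2 + s ^ 2)"
    by (simp add: grad_const_def algebra_simps)
  finally show ?thesis by (simp add: e_def)
qed

end

text \<open>\<open>gap\<close> concerns a single objective: acceptance forces a decrease of all of
  them, so the objective with the least room to decrease may be used.\<close>

locale cubic_run = cubic_method +
  fixes x0 x1 :: fvec and c :: "nat \<Rightarrow> alg_state" and gap :: real
  assumes run: "alg_run n m F \<beta> \<sigma>1 \<theta> \<alpha> x0 x1 c"
    and distinct: "\<And>s. x_cur (c s) \<noteq> x_prev (c s)"
    and gap: "\<exists>j<m. \<forall>y\<in>Rn n. F j x1 - F j y \<le> gap"
begin

lemma init: "c 0 = \<lparr>outer_idx = 1, inner_idx = first_inner \<alpha> \<sigma>1 \<sigma>1, x_prev = x0, x_cur = x1,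
    sigma_cur = \<sigma>1, evals = 0\<rparr>"
  and x0_in_Rn: "x0 \<in> Rn n" and x1_in_Rn: "x1 \<in> Rn n"
  and step: "alg_step n m F \<beta> \<sigma>1 \<theta> \<alpha> (c s) (c (Suc s))"
  using run by (simp_all add: alg_run_def)

definition sigma_bound :: real where "sigma_bound = sigma_base * dimfac"

lemma sigma_bound_ge: "\<sigma>1 \<le> sigma_bound" "(60 * L + 1) * dimfac \<le> sigma_bound"
proof -
  show "(60 * L + 1) * dimfac \<le> sigma_bound"
    unfolding sigma_bound_def sigma_base_def using dimfac_ge_1 by (intro mult_right_mono) auto
  have "\<sigma>1 * 1 \<le> sigma_bound"
    unfolding sigma_bound_def sigma_base_def using dimfac_ge_1 \<sigma>1 by (intro mult_mono) auto
  then show "\<sigma>1 \<le> sigma_bound" by simp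
qed

lemma x_in_Rn: "x_cur (c s) \<in> Rn n" "x_prev (c s) \<in> Rn n"
proof (induction s)
  case 0
  show "x_cur (c 0) \<in> Rn n" "x_prev (c 0) \<in> Rn n" using init x0_in_Rn x1_in_Rn by simp_all
next
  case (Suc s)
  from step[of s] show "x_cur (c (Suc s)) \<in> Rn n" "x_prev (c (Suc s)) \<in> Rn n"
    by (cases rule: alg_step_cases; use Suc in \<open>auto simp: trial_ok_def\<close>)+
qed

text \<open>\<open>incr * sigma_cur\<close> is the candidate for the next parameter. A rejection
  multiplies it by \<open>\<alpha>\<close> but happens only below the threshold, so at most one
  factor \<open>\<alpha>\<close> is overshot. Acceptance makes it the parameter and resets the index
  to 0 or 1, so the new candidate is not larger.\<close>

lemma sigma_invariant:
  shows sigma_ge: "\<sigma>1 \<le> sigma_cur (c s)" and sigma_le: "sigma_cur (c s) \<le> \<alpha> * sigma_bound"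
    and incr_ge: "\<sigma>1 \<le> incr (c s) * sigma_cur (c s)"
    and incr_le: "incr (c s) * sigma_cur (c s) \<le> \<alpha> * sigma_bound"
proof (induction s)
  case 0
  have "first_inner \<alpha> \<sigma>1 \<sigma>1 \<le> 1" "\<sigma>1 \<le> incr (c 0) * \<sigma>1"
    using first_inner_props[of \<sigma>1 \<sigma>1 \<alpha>] \<sigma>1 by (simp_all add: init incr_def)
  moreover have "\<sigma>1 \<le> \<alpha> * sigma_bound"
    using \<alpha> sigma_bound_ge(1) \<sigma>1 mult_mono[of 1 \<alpha> \<sigma>1 sigma_bound] by simp
  ultimately show "\<sigma>1 \<le> sigma_cur (c 0)" "sigma_cur (c 0) \<le> \<alpha> * sigma_bound"
    "\<sigma>1 \<le> incr (c 0) * sigma_cur (c 0)" "incr (c 0) * sigma_cur (c 0) \<le> \<alpha> * sigma_bound"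
    using incr_mult_le[of "c 0" \<sigma>1] \<sigma>1 by (simp_all add: init)
next
  case (Suc s)
  from step[of s] have "\<sigma>1 \<le> sigma_cur (c (Suc s)) \<and> sigma_cur (c (Suc s)) \<le> \<alpha> * sigma_bound \<and>
    \<sigma>1 \<le> incr (c (Suc s)) * sigma_cur (c (Suc s)) \<and>
    incr (c (Suc s)) * sigma_cur (c (Suc s)) \<le> \<alpha> * sigma_bound"
  proof (cases rule: alg_step_cases)
    case (accept S y w)
    have \<sigma>: "sigma_cur (c (Suc s)) = incr (c s) * sigma_cur (c s)" using accept(6) by (simp add: incr_def)
    then have "\<sigma>1 \<le> sigma_cur (c (Suc s))" using Suc.IH(3) by simp
    from first_inner_props[OF \<sigma>1 this, of \<alpha>] this show ?thesis
      using incr_mult_le[of "c (Suc s)" "sigma_cur (c (Suc s))"] \<sigma> \<sigma>1 Suc.IH(4)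
      by (simp add: incr_def[of "c (Suc s)"] accept(7))
  next
    case (reject S y w)
    have incr: "incr (c (Suc s)) = \<alpha> * incr (c s)" using \<alpha> by (simp add: incr_eq reject(7))
    have "\<not> (60 * L + 1) * dimfac \<le> incr (c s) * sigma_cur (c s)"
      using sufficient_decreaseI[OF x_in_Rn(1) distinct reject(1)] reject(2) by blast
    then have "\<alpha> * (incr (c s) * sigma_cur (c s)) \<le> \<alpha> * sigma_bound"
      using \<alpha> sigma_bound_ge(2) by (intro mult_left_mono) auto
    moreover have "incr (c s) * sigma_cur (c s) \<le> \<alpha> * (incr (c s) * sigma_cur (c s))"
      using \<alpha> Suc.IH(3) \<sigma>1 mult_right_mono[of 1 \<alpha> "incr (c s) * sigma_cur (c s)"] by simp
    ultimately show ?thesis using Suc.IH by (simp add: incr reject(6) mult.assoc)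
  qed
  then show "\<sigma>1 \<le> sigma_cur (c (Suc s))" "sigma_cur (c (Suc s)) \<le> \<alpha> * sigma_bound"
    "\<sigma>1 \<le> incr (c (Suc s)) * sigma_cur (c (Suc s))"
    "incr (c (Suc s)) * sigma_cur (c (Suc s)) \<le> \<alpha> * sigma_bound"
    by blast+
qed

lemma sigma_pos: "0 < sigma_cur (c s)"
  using sigma_ge[of s] \<sigma>1 by simp

section \<open>Inner iterations in terms of outer iterations\<close>

lemma evals_eq: "evals (c s) = s * (m * (2 * n + 4 * n ^ 2 + 2))"
proof (induction s)
  case (Suc s)
  from step[of s] Suc show ?case by (cases rule: alg_step_cases) simp_all
qed (simp add: init)

text \<open>An outer iteration that ends with index \<open>i\<close> takes at most \<open>i + 1\<close> inner iterations and multiplies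
  \<open>\<sigma>\<close> by \<open>\<alpha>\<^sup>i\<^sup>-\<^sup>1\<close>, so all but two of them are paid for by the growth of \<open>log\<^sub>\<alpha> \<sigma>\<close>.\<close>

lemma inner_iterations_le_potential:
  "real s \<le> 2 * (real (outer_idx (c s)) - 1) + real (inner_idx (c s)) + log \<alpha> (sigma_cur (c s) / \<sigma>1)"
proof (induction s)
  case (Suc s)
  from step[of s] show ?case
  proof (cases rule: alg_step_cases)
    case (accept S y w)
    have "log \<alpha> (sigma_cur (c (Suc s)) / \<sigma>1) = log \<alpha> (incr (c s) * (sigma_cur (c s) / \<sigma>1))"
      by (simp add: accept(6) incr_def)
    also have "\<dots> = log \<alpha> (incr (c s)) + log \<alpha> (sigma_cur (c s) / \<sigma>1)"
      using incr_pos[of "c s"] sigma_pos[of s] \<sigma>1 by (subst log_mult_pos) auto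
    also have "log \<alpha> (incr (c s)) = real (inner_idx (c s)) - 1"
      using \<alpha> by (simp add: incr_eq log_divide_pos log_nat_power)
    finally show ?thesis using Suc accept(3) by simp
  next
    case (reject S y w)
    then show ?thesis using Suc by simp
  qed
qed (simp add: init \<sigma>1 less_imp_neq[OF \<sigma>1, symmetric])

definition log_bound :: real where "log_bound = 1 + log \<alpha> (sigma_bound / \<sigma>1)"

text \<open>Both state-dependent terms of the potential are bounded: the logarithm by
  \<open>sigma_le\<close>, the current index by \<open>incr_le\<close>, because
  \<open>log \<alpha> (incr (c s))\<close> equals the index minus 1. In particular no inner loop
  runs forever.\<close>

lemma inner_iterations_le:
  "real s \<le> 2 * (real (outer_idx (c s)) - 1) + 2 * log_bound + 1"
proof -
  have \<sigma>b: "0 < sigma_bound" using sigma_bound_ge(1) \<sigma>1 by simp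
  have eq: "log \<alpha> (\<alpha> * sigma_bound / \<sigma>1) = log_bound"
    using \<alpha> \<sigma>b \<sigma>1 by (simp add: log_bound_def log_mult_pos log_divide_pos)
  have "log \<alpha> (sigma_cur (c s) / \<sigma>1) \<le> log \<alpha> (\<alpha> * sigma_bound / \<sigma>1)"
    using \<alpha> \<sigma>b \<sigma>1 sigma_pos[of s] sigma_le[of s] by (subst log_le_cancel_iff) (auto simp: divide_right_mono)
  moreover have "real (inner_idx (c s)) - 1 \<le> log \<alpha> (\<alpha> * sigma_bound / \<sigma>1)"
  proof -
    have "incr (c s) * \<sigma>1 \<le> incr (c s) * sigma_cur (c s)"
      using sigma_ge[of s] incr_pos[of "c s"] by simp
    also note incr_le
    finally have "incr (c s) \<le> \<alpha> * sigma_bound / \<sigma>1" using \<sigma>1 by (simp add: field_simps)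
    then have "log \<alpha> (incr (c s)) \<le> log \<alpha> (\<alpha> * sigma_bound / \<sigma>1)"
      using \<alpha> \<sigma>b \<sigma>1 incr_pos[of "c s"] by (subst log_le_cancel_iff) auto
    then show ?thesis using \<alpha> by (simp add: incr_eq log_divide_pos log_nat_power)
  qed
  ultimately show ?thesis using inner_iterations_le_potential[of s] unfolding eq by linarith
qed

end

section \<open>Counting iterations\<close>

text \<open>One of the two squares is at least \<open>u\<close>, and its cube alone
  suffices.\<close>

lemma powr_three_halves_le_cubes:
  fixes a b u :: real
  assumes "0 \<le> a" "0 \<le> b" "0 < u" "2 * u < a ^ 2 + b ^ 2"
  shows "u powr (3 / 2) \<le> a ^ 3 + b ^ 3"
proof -
  have *: "u powr (3 / 2) \<le> z ^ 3" if "u \<le> z ^ 2" "0 \<le> z" for z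
  proof -
    have "u powr (3 / 2) \<le> (z ^ 2) powr (3 / 2)"
      using that assms(3) by (intro powr_mono2) auto
    also have "z ^ 2 = z powr 2" using that assms(3) by (cases "z = 0") (auto simp: powr_numeral)
    also have "(z powr 2) powr (3 / 2) = z powr 3" by (simp add: powr_powr)
    also have "\<dots> = z ^ 3" using that assms(3) by (cases "z = 0") (auto simp: powr_numeral)
    finally show ?thesis .
  qed
  have "u \<le> a ^ 2 \<or> u \<le> b ^ 2" using assms(4) by linarith
  then show ?thesis
    using *[of a] *[of b] assms(1,2) zero_le_power[of a 3] zero_le_power[of b 3] by linarith
qed

context cubic_run
begin

abbreviation critical :: "real \<Rightarrow> nat \<Rightarrow> bool" where
  "critical \<epsilon> s \<equiv> approx_pareto_critical n m F \<epsilon> (x_cur (c s))"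

definition min_progress :: "real \<Rightarrow> real" where
  "min_progress \<epsilon> = (\<epsilon> / (2 * grad_const * dimfac)) powr (3 / 2)"

text \<open>The multipliers \<open>w\<close> of the accepted point are admissible weights for
  criticality. Hence at a noncritical point the weighted gradient exceeds \<open>\<epsilon>\<close>,
  and \<open>trial_gradient_le\<close> forces one of the two adjacent steps to be long.\<close>

lemma min_progress_le:
  assumes trial: "trial_ok n m F \<beta> \<theta> \<alpha> S (c s) (x_cur (c (Suc s))) w"
    and prev: "x_prev (c (Suc s)) = x_cur (c s)"
    and "0 < \<epsilon>" "\<not> critical \<epsilon> (Suc s)"
  shows "min_progress \<epsilon> \<le> radius (c s) ^ 3 + radius (c (Suc s)) ^ 3"
proof -
  let ?y = "x_cur (c (Suc s))"
  have y: "?y \<noteq> x_cur (c s)" using distinct[of "Suc s"] prev by simp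
  note trial' = trial_okD[OF x_in_Rn(1) distinct trial]
  have "\<epsilon> < norm (\<Sum>j<m. w j *\<^sub>R gradient n (F j) ?y)"
    using assms(4) trial'(1-3) unfolding approx_pareto_critical_def not_le[symmetric] by blast
  also have "\<dots> \<le> grad_const * dimfac * (radius (c s) ^ 2 + radius (c (Suc s)) ^ 2)"
    using trial_gradient_le[OF x_in_Rn(1) distinct trial y] sigma_pos[of s] incr_le[of s]
    by (simp add: sigma_bound_def prev)
  finally have "2 * (\<epsilon> / (2 * grad_const * dimfac)) < radius (c s) ^ 2 + radius (c (Suc s)) ^ 2"
    using grad_const_pos dimfac_ge_1 by (simp add: divide_less_eq mult_ac)
  then show ?thesis
    unfolding min_progress_def using grad_const_pos dimfac_ge_1 \<open>0 < \<epsilon>\<close>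
    by (intro powr_three_halves_le_cubes) auto
qed

text \<open>\<open>G\<close> is the sum of the cubes of the steps taken so far. It is bounded because the weight
  \<open>\<alpha> \<sigma>\<^sub>t\<^sub>+\<^sub>1 / 12\<close> with which a step enters the decrease condition exceeds the weight \<open>\<sigma>\<^sub>t\<^sub>+\<^sub>1 / 12\<close> with
  which it is subtracted in the next iteration.\<close>

lemma energy_invariant:
  assumes "0 < \<epsilon>" "\<And>s'. s' \<le> s \<Longrightarrow> \<not> critical \<epsilon> s'"
  shows "\<exists>G\<ge>0.
    (\<forall>j<m. F j (x_cur (c s)) + sigma_cur (c s) / 12 * radius (c s) ^ 3 + (\<alpha> - 1) * \<sigma>1 / 12 * G
        \<le> F j x1 + \<sigma>1 / 12 * norm (x1 - x0) ^ 3) \<and>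
    (real (outer_idx (c s)) - 1) * min_progress \<epsilon> + radius (c s) ^ 3 \<le> 2 * G + norm (x1 - x0) ^ 3"
  using assms(2)
proof (induction s)
  case 0
  show ?case by (rule exI[of _ 0]) (simp add: init)
next
  case (Suc s)
  then obtain G where G: "0 \<le> G"
    and energy: "\<And>j. j < m \<Longrightarrow> F j (x_cur (c s)) + sigma_cur (c s) / 12 * radius (c s) ^ 3
        + (\<alpha> - 1) * \<sigma>1 / 12 * G \<le> F j x1 + \<sigma>1 / 12 * norm (x1 - x0) ^ 3"
    and count: "(real (outer_idx (c s)) - 1) * min_progress \<epsilon> + radius (c s) ^ 3 \<le> 2 * G + norm (x1 - x0) ^ 3"
    by auto
  from step[of s] show ?case
  proof (cases rule: alg_step_cases)
    case (accept S y w)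
    define \<rho> \<sigma>' where "\<rho> = radius (c (Suc s)) ^ 3" and "\<sigma>' = sigma_cur (c (Suc s))"
    have \<rho>: "0 \<le> \<rho>" by (simp add: \<rho>_def)
    have \<sigma>': "\<alpha> ^ inner_idx (c s) * sigma_cur (c s) = \<alpha> * \<sigma>'"
      using accept(6) incr_eq[of "c s"] \<alpha> by (simp add: \<sigma>'_def incr_def)
    have "F j (x_cur (c (Suc s))) + \<sigma>' / 12 * \<rho> + (\<alpha> - 1) * \<sigma>1 / 12 * (G + \<rho>)
        \<le> F j x1 + \<sigma>1 / 12 * norm (x1 - x0) ^ 3" if j: "j < m" for j
    proof -
      have "\<alpha> * \<sigma>' / 12 * \<rho> - sigma_cur (c s) / 12 * radius (c s) ^ 3
          \<le> F j (x_cur (c s)) - F j (x_cur (c (Suc s)))"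
        using accept(2) j \<sigma>' unfolding sufficient_decrease_def by (auto simp: accept(4,5) \<rho>_def)
      moreover have "(\<alpha> - 1) * \<sigma>1 / 12 * \<rho> \<le> (\<alpha> - 1) * \<sigma>' / 12 * \<rho>"
        using sigma_ge[of "Suc s"] \<alpha> \<rho> by (intro mult_right_mono divide_right_mono mult_left_mono) (auto simp: \<sigma>'_def)
      moreover have "(\<alpha> - 1) * \<sigma>' / 12 * \<rho> = \<alpha> * \<sigma>' / 12 * \<rho> - \<sigma>' / 12 * \<rho>"
        by (simp add: algebra_simps diff_divide_distrib)
      ultimately show ?thesis using energy[OF j] unfolding distrib_left by linarith
    qed
    moreover have "min_progress \<epsilon> \<le> radius (c s) ^ 3 + \<rho>"
      using min_progress_le[of S s w \<epsilon>] accept assms(1) Suc.prems[of "Suc s"] by (simp add: \<rho>_def)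
    \<comment> \<open>Each cube occurs in two consecutive progress inequalities, now as
      \<open>\<rho>\<close> and at the next acceptance as the preceding radius; this explains
      \<open>2 * G\<close>. The initial step occurs once and is kept separately.\<close>
    then have "(real (outer_idx (c (Suc s))) - 1) * min_progress \<epsilon> + \<rho> \<le> 2 * (G + \<rho>) + norm (x1 - x0) ^ 3"
      using count by (simp add: accept(3) algebra_simps)
    ultimately show ?thesis
      using G \<rho> by (intro exI[of _ "G + \<rho>"]) (simp add: \<rho>_def \<sigma>'_def)
  next
    case (reject S y w)
    then show ?thesis using G energy count by (intro exI[of _ G]) simp
  qed
qed

text \<open>The energy bound solved for \<open>2 * G\<close>, where 24 is twice the 12 of the
  decrease condition, plus the cube of the initial step.\<close>

definition cube_budget :: real where
  "cube_budget = 24 * (gap + \<sigma>1 / 12 * norm (x1 - x0) ^ 3) / ((\<alpha> - 1) * \<sigma>1) + norm (x1 - x0) ^ 3"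

lemma outer_iterations_le:
  assumes "0 < \<epsilon>" "\<And>s'. s' \<le> s \<Longrightarrow> \<not> critical \<epsilon> s'"
  shows "(real (outer_idx (c s)) - 1) * min_progress \<epsilon> \<le> cube_budget"
proof -
  obtain G where "0 \<le> G"
    and energy: "\<And>j. j < m \<Longrightarrow> F j (x_cur (c s)) + sigma_cur (c s) / 12 * radius (c s) ^ 3
        + (\<alpha> - 1) * \<sigma>1 / 12 * G \<le> F j x1 + \<sigma>1 / 12 * norm (x1 - x0) ^ 3"
    and count: "(real (outer_idx (c s)) - 1) * min_progress \<epsilon> + radius (c s) ^ 3 \<le> 2 * G + norm (x1 - x0) ^ 3"
    using energy_invariant[OF assms] by auto
  obtain j where j: "j < m" "F j x1 - F j (x_cur (c s)) \<le> gap"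
    using gap x_in_Rn by blast
  have "0 \<le> sigma_cur (c s) / 12 * radius (c s) ^ 3" using sigma_pos[of s] by simp
  then have "(\<alpha> - 1) * \<sigma>1 / 12 * G \<le> gap + \<sigma>1 / 12 * norm (x1 - x0) ^ 3"
    using energy[OF j(1)] j(2) by linarith
  then have "2 * G \<le> 24 * (gap + \<sigma>1 / 12 * norm (x1 - x0) ^ 3) / ((\<alpha> - 1) * \<sigma>1)"
    using \<alpha> \<sigma>1 by (simp add: field_simps)
  moreover have "0 \<le> radius (c s) ^ 3" by simp
  ultimately show ?thesis using count unfolding cube_budget_def by linarith
qed

lemma cube_budget_nonneg: "0 \<le> cube_budget"
proof -
  have "0 \<le> gap" using gap x1_in_Rn by force
  then show ?thesis using \<alpha> \<sigma>1 by (simp add: cube_budget_def)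
qed

text \<open>The final 1 pays for the outer index starting at 1.\<close>

definition outer_const :: real where
  "outer_const = cube_budget * (2 * grad_const) powr (3 / 2) + 1"

definition inner_const :: real where
  "inner_const = 2 * outer_const + 2 + 2 * (sigma_base / (\<sigma>1 * ln \<alpha>))"

section \<open>Rates in the dimension and the accuracy\<close>

context
  fixes \<epsilon> :: real
  assumes \<epsilon>: "0 < \<epsilon>" "\<epsilon> \<le> 1"
begin

definition rate :: real where
  "rate = real n powr (3 * (1 - \<beta>) / 2) * \<epsilon> powr (- 3 / 2)"

lemma rate_eq: "rate = dimfac powr (3 / 2) * \<epsilon> powr (- 3 / 2)"
  by (simp add: rate_def dimfac_def powr_powr mult_ac)

text \<open>This absorbs additive constants and the logarithmic overhead of the inner loops into the
  rate.\<close>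

lemma dimfac_le_rate: "dimfac \<le> rate"
proof -
  have "dimfac powr 1 * 1 \<le> rate"
    unfolding rate_eq using dimfac_ge_1 \<epsilon> powr_mono2'[of "- 3 / 2" \<epsilon> 1]
    by (intro mult_mono powr_mono) auto
  then show ?thesis using dimfac_ge_1 by simp
qed

lemma outer_idx_le:
  assumes "\<And>s'. s' \<le> s \<Longrightarrow> \<not> critical \<epsilon> s'"
  shows "real (outer_idx (c s)) \<le> outer_const * rate"
proof -
  have pos: "0 < 2 * grad_const" "0 < dimfac" using grad_const_pos dimfac_ge_1 by auto
  have "min_progress \<epsilon> = \<epsilon> powr (3 / 2) / ((2 * grad_const) powr (3 / 2) * dimfac powr (3 / 2))"
    using pos \<epsilon> by (simp add: min_progress_def powr_divide powr_mult)
  also have "\<epsilon> powr (3 / 2) = inverse (\<epsilon> powr (- 3 / 2))"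
    by (simp add: powr_minus)
  finally have eq: "1 / min_progress \<epsilon> = (2 * grad_const) powr (3 / 2) * rate"
    by (simp add: rate_eq inverse_eq_divide)
  have "0 < min_progress \<epsilon>" using pos \<epsilon> by (simp add: min_progress_def)
  then have "real (outer_idx (c s)) - 1 \<le> cube_budget * (1 / min_progress \<epsilon>)"
    using outer_iterations_le[OF \<epsilon>(1) assms] by (simp add: field_simps)
  then show ?thesis
    using dimfac_le_rate dimfac_ge_1 unfolding eq by (simp add: outer_const_def algebra_simps)
qed

lemma inner_iterations_less:
  assumes "\<And>s'. s' \<le> s \<Longrightarrow> \<not> critical \<epsilon> s'"
  shows "real s + 1 \<le> inner_const * rate"
proof -
  define t where "t = sigma_base / (\<sigma>1 * ln \<alpha>) * rate"
  \<comment> \<open>Bounding the logarithm linearly costs a factor \<open>dimfac\<close>, which the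
    rate dominates, so no logarithm of \<open>n\<close> survives.\<close>
  have "log \<alpha> (sigma_bound / \<sigma>1) \<le> sigma_bound / \<sigma>1 / ln \<alpha>"
    unfolding log_def using \<alpha> \<sigma>1 sigma_bound_ge(1) ln_le_minus_one[of "sigma_bound / \<sigma>1"]
    by (intro divide_right_mono) auto
  also have "\<dots> = sigma_base / (\<sigma>1 * ln \<alpha>) * dimfac"
    by (simp add: sigma_bound_def)
  also have "\<dots> \<le> sigma_base / (\<sigma>1 * ln \<alpha>) * rate"
    using dimfac_le_rate \<alpha> \<sigma>1 sigma_base_pos by (intro mult_left_mono) auto
  finally have "log_bound \<le> 1 + t"
    by (simp add: log_bound_def t_def)
  moreover have "real (outer_idx (c s)) \<le> outer_const * rate"
    by (rule outer_idx_le[OF assms])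
  moreover have "1 \<le> rate" using dimfac_le_rate dimfac_ge_1 by simp
  moreover have "inner_const * rate = 2 * (outer_const * rate) + 2 * rate + 2 * t"
    by (simp add: inner_const_def t_def algebra_simps)
  ultimately show ?thesis
    using inner_iterations_le[of s] by argo
qed

text \<open>The bound on noncritical prefixes shows that a critical state occurs. At the first one,
  the estimates are applied to its predecessor, and the last inner iteration raises \<open>s\<close>
  and the outer index by at most 1; the initial state is treated separately.\<close>

lemma complexity:
  obtains s where "critical \<epsilon> s" "real (outer_idx (c s)) - 1 \<le> outer_const * rate"
    "real s \<le> inner_const * rate"
proof -
  obtain N where "inner_const * rate < real N" using reals_Archimedean2 by blast
  then have "\<not> (\<forall>s'\<le>N. \<not> critical \<epsilon> s')" using inner_iterations_less[of N] by force
  then have ex: "\<exists>s. critical \<epsilon> s" by blast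
  define s where "s = (LEAST s. critical \<epsilon> s)"
  have crit: "critical \<epsilon> s" unfolding s_def using ex by (rule LeastI_ex)
  have before: "\<not> critical \<epsilon> s'" if "s' < s" for s' using that not_less_Least unfolding s_def by blast
  show ?thesis
  proof (cases s)
    case 0
    have "0 \<le> outer_const" by (simp add: outer_const_def cube_budget_nonneg)
    moreover from this have "0 \<le> inner_const"
      using \<alpha> \<sigma>1 sigma_base_pos by (simp add: inner_const_def)
    moreover have "0 \<le> rate" by (simp add: rate_def)
    ultimately show ?thesis using 0 by (intro that[OF crit]) (simp_all add: init)
  next
    case (Suc s0)
    then have before: "\<And>s'. s' \<le> s0 \<Longrightarrow> \<not> critical \<epsilon> s'" using before by simp
    have "outer_idx (c s) \<le> outer_idx (c s0) + 1"
      using step[of s0] Suc by (cases rule: alg_step_cases) simp_all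
    with outer_idx_le[of s0, OF before] inner_iterations_less[of s0, OF before] show ?thesis
      using Suc by (intro that[OF crit]) simp_all
  qed
qed

end

end

section \<open>Uniform constants and the final bounds\<close>

lemma mat_norm_nonneg: "0 \<le> mat_norm n A"
  unfolding mat_norm_def by (rule onorm_pos_le[OF bounded_linear_mat_vec])

lemma lipschitz_hessianI:
  assumes n: "1 \<le> n" and f: "twice_cont_diff n f"
    and lipschitz: "\<And>y z. y \<in> Rn n \<Longrightarrow> z \<in> Rn n \<Longrightarrow>
      mat_norm n (\<lambda>k l. hessian n f y k l - hessian n f z k l) \<le> K * norm (y - z)"
    and "K \<le> L"
  shows "lipschitz_hessian n f L"
proof
  \<comment> \<open>The points \<open>unit_vec 0\<close> and \<open>0\<close> have distance 1, so
    their Lipschitz bound is \<open>K\<close> itself; \<open>1 \<le> n\<close> puts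
    \<open>unit_vec 0\<close> into \<open>Rn n\<close>.\<close>
  have "0 \<le> K * norm (unit_vec 0 - 0)"
    using n by (intro order_trans[OF mat_norm_nonneg lipschitz]) (auto simp: unit_vec_in_Rn Rn_def)
  then show "0 \<le> L" using \<open>K \<le> L\<close> by simp
  show "mat_norm n (\<lambda>k l. hessian n f y k l - hessian n f z k l) \<le> L * norm (y - z)"
    if "y \<in> Rn n" "z \<in> Rn n" for y z
    using lipschitz[OF that] mult_right_mono[OF \<open>K \<le> L\<close>, of "norm (y - z)"] by simp
qed (rule f)

text \<open>The locale constants written out as functions of the six admissible parameters, so that
  they can be chosen before \<open>n\<close>, \<open>m\<close>, \<open>\<beta>\<close> and
  \<open>\<epsilon>\<close>.\<close>

definition outer_bound :: "real \<Rightarrow> real \<Rightarrow> real \<Rightarrow> real \<Rightarrow> real \<Rightarrow> real \<Rightarrow> real" where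
  "outer_bound L \<theta> \<sigma>1 \<alpha> \<Delta> d =
     (24 * (\<Delta> + \<sigma>1 / 12 * d ^ 3) / ((\<alpha> - 1) * \<sigma>1) + d ^ 3)
       * (2 * (\<theta> + L + 4 * \<alpha> * L + \<alpha> ^ 2 * max \<sigma>1 (60 * L + 1) + 1)) powr (3 / 2) + 1"

definition inner_bound :: "real \<Rightarrow> real \<Rightarrow> real \<Rightarrow> real \<Rightarrow> real \<Rightarrow> real \<Rightarrow> real" where
  "inner_bound L \<theta> \<sigma>1 \<alpha> \<Delta> d =
     2 * outer_bound L \<theta> \<sigma>1 \<alpha> \<Delta> d + 2 + 2 * (max \<sigma>1 (60 * L + 1) / (\<sigma>1 * ln \<alpha>))"

theorem mainTheorem3:
  shows "\<exists>C1 C2 :: real \<Rightarrow> real \<Rightarrow> real \<Rightarrow> real \<Rightarrow> real \<Rightarrow> real \<Rightarrow> real.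
    \<forall>(n::nat) (m::nat) (F :: nat \<Rightarrow> fvec \<Rightarrow> real) (Lj :: nat \<Rightarrow> real) (Fstar :: nat \<Rightarrow> real)
      (\<beta>::real) (\<sigma>1::real) (\<theta>::real) (\<alpha>::real) (x0::fvec) (x1::fvec) (c :: nat \<Rightarrow> alg_state) (\<epsilon>::real).
      1 \<le> n \<longrightarrow> 1 \<le> m \<longrightarrow>
      (\<forall>j<m. twice_cont_diff n (F j)) \<longrightarrow>
      (\<forall>j<m. \<forall>y\<in>Rn n. \<forall>z\<in>Rn n.
         mat_norm n (\<lambda>k l. hessian n (F j) y k l - hessian n (F j) z k l) \<le> Lj j * norm (y - z)) \<longrightarrow>
      (\<forall>j<m. \<forall>y\<in>Rn n. Fstar j \<le> F j y) \<longrightarrow>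
      0 \<le> \<beta> \<longrightarrow> \<beta> \<le> 1 \<longrightarrow>
      alg_run n m F \<beta> \<sigma>1 \<theta> \<alpha> x0 x1 c \<longrightarrow>
      (\<forall>s. x_cur (c s) \<noteq> x_prev (c s)) \<longrightarrow>
      0 < \<epsilon> \<longrightarrow> \<epsilon> \<le> 1 \<longrightarrow>
      (let L = Max (Lj ` {..<m});
           \<Delta> = Min ((\<lambda>j. F j x1 - Fstar j) ` {..<m});
           d = norm (x1 - x0)
       in \<exists>s. approx_pareto_critical n m F \<epsilon> (x_cur (c s)) \<and>
            real (outer_idx (c s)) - 1
              \<le> C1 L \<theta> \<sigma>1 \<alpha> \<Delta> d * real n powr (3 * (1 - \<beta>) / 2) * \<epsilon> powr (- 3 / 2) \<and>
            real (evals (c s))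
              \<le> C2 L \<theta> \<sigma>1 \<alpha> \<Delta> d * real m * real n powr ((7 - 3 * \<beta>) / 2) * \<epsilon> powr (- 3 / 2))"
proof (rule exI[of _ outer_bound], rule exI[of _ "\<lambda>L \<theta> \<sigma>1 \<alpha> \<Delta> d. 8 * inner_bound L \<theta> \<sigma>1 \<alpha> \<Delta> d"],
    intro allI impI, unfold Let_def)
  fix n m :: nat and F :: "nat \<Rightarrow> fvec \<Rightarrow> real" and Lj Fstar :: "nat \<Rightarrow> real"
    and \<beta> \<sigma>1 \<theta> \<alpha> :: real and x0 x1 :: fvec and c :: "nat \<Rightarrow> alg_state" and \<epsilon> :: real
  assume n: "1 \<le> n" and m: "1 \<le> m"
    and C2: "\<forall>j<m. twice_cont_diff n (F j)"
    and lipschitz: "\<forall>j<m. \<forall>y\<in>Rn n. \<forall>z\<in>Rn n.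
         mat_norm n (\<lambda>k l. hessian n (F j) y k l - hessian n (F j) z k l) \<le> Lj j * norm (y - z)"
    and bounded: "\<forall>j<m. \<forall>y\<in>Rn n. Fstar j \<le> F j y"
    and \<beta>: "0 \<le> \<beta>" "\<beta> \<le> 1"
    and run: "alg_run n m F \<beta> \<sigma>1 \<theta> \<alpha> x0 x1 c"
    and distinct: "\<forall>s. x_cur (c s) \<noteq> x_prev (c s)"
    and \<epsilon>: "0 < \<epsilon>" "\<epsilon> \<le> 1"
  let ?L = "Max (Lj ` {..<m})" and ?\<Delta> = "Min ((\<lambda>j. F j x1 - Fstar j) ` {..<m})"
    and ?d = "norm (x1 - x0)"
  have ne: "{..<m} \<noteq> {}" using m by (auto simp: lessThan_empty_iff)
  interpret cubic_run n m F ?L \<beta> \<sigma>1 \<theta> \<alpha> x0 x1 c ?\<Delta>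
  proof (intro cubic_run.intro cubic_method.intro cubic_run_axioms.intro)
    show "lipschitz_hessian n (F j) ?L" if "j < m" for j
      using that C2 lipschitz by (intro lipschitz_hessianI[OF n, of _ "Lj j"]) auto
    \<comment> \<open>The objective attaining the minimum is the witness for
      \<open>gap\<close>.\<close>
    have "?\<Delta> \<in> (\<lambda>j. F j x1 - Fstar j) ` {..<m}"
      using ne by (intro Min_in) auto
    then show "\<exists>j<m. \<forall>y\<in>Rn n. F j x1 - F j y \<le> ?\<Delta>" using bounded by fastforce
  qed (use n m \<beta> run distinct in \<open>auto simp: alg_run_def\<close>)
  have outer: "outer_const = outer_bound ?L \<theta> \<sigma>1 \<alpha> ?\<Delta> ?d"
    by (simp add: outer_const_def outer_bound_def cube_budget_def grad_const_def sigma_base_def)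
  then have inner: "inner_const = inner_bound ?L \<theta> \<sigma>1 \<alpha> ?\<Delta> ?d"
    by (simp add: inner_const_def inner_bound_def sigma_base_def)
  obtain s where crit: "approx_pareto_critical n m F \<epsilon> (x_cur (c s))"
    and outer_le: "real (outer_idx (c s)) - 1 \<le> outer_const * rate \<epsilon>"
    and inner_le: "real s \<le> inner_const * rate \<epsilon>"
    using complexity[OF \<epsilon>] by blast
  \<comment> \<open>The evaluations per objective and inner iteration are merged into
    \<open>8 * n ^ 2\<close>, the source of the factor 8 in the second constant.\<close>
  have "2 * n + 4 * n ^ 2 + 2 \<le> 8 * n ^ 2"
    using n self_le_power[of n 2] by linarith
  then have "real (2 * n + 4 * n ^ 2 + 2) \<le> real (8 * n ^ 2)"
    by (simp only: of_nat_le_iff)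
  then have "real s * (real m * real (2 * n + 4 * n ^ 2 + 2)) \<le> (inner_const * rate \<epsilon>) * (real m * real (8 * n ^ 2))"
    using inner_le by (intro mult_mono) auto
  then have "real (evals (c s)) \<le> (inner_const * rate \<epsilon>) * (real m * real (8 * n ^ 2))"
    by (simp only: evals_eq of_nat_mult)
  also have "real (8 * n ^ 2) = 8 * real n powr 2"
    using n by (simp add: powr_numeral)
  also have "(inner_const * rate \<epsilon>) * (real m * (8 * real n powr 2)) =
      8 * inner_const * real m * (real n powr 2 * real n powr (3 * (1 - \<beta>) / 2)) * \<epsilon> powr (- 3 / 2)"
    by (simp add: rate_def[OF \<epsilon>])
  also have "real n powr 2 * real n powr (3 * (1 - \<beta>) / 2) = real n powr ((7 - 3 * \<beta>) / 2)"
    unfolding powr_add[symmetric] by (rule arg_cong[where f = "(powr) (real n)"]) (simp add: field_simps)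
  finally have evals_le: "real (evals (c s)) \<le> 8 * inner_const * real m * real n powr ((7 - 3 * \<beta>) / 2) * \<epsilon> powr (- 3 / 2)" .
  show "\<exists>s. approx_pareto_critical n m F \<epsilon> (x_cur (c s)) \<and>
      real (outer_idx (c s)) - 1
        \<le> outer_bound ?L \<theta> \<sigma>1 \<alpha> ?\<Delta> ?d * real n powr (3 * (1 - \<beta>) / 2) * \<epsilon> powr (- 3 / 2) \<and>
      real (evals (c s))
        \<le> 8 * inner_bound ?L \<theta> \<sigma>1 \<alpha> ?\<Delta> ?d * real m * real n powr ((7 - 3 * \<beta>) / 2) * \<epsilon> powr (- 3 / 2)"
    using crit outer_le evals_le unfolding outer inner by (auto simp: rate_def[OF \<epsilon>])
qed

end
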